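(* Suppose that $H$ is a word hyperbolic group and that $$1 \longrightarrow \mathbb{Z} \longrightarrow G \longrightarrow H \longrightarrow 1$$ is a short exact sequence of groups. Then there is a generating set $\mathcal{G}$ for $G$ such that $G$ is almost convex with respect to $\mathcal{G}$.
   Context: Generating sets: a generating set $\mathcal{G}$ of a group $G$ is always a finite subset of $G$ closed under inversion that generates $G$. The Cayley graph $\Gamma=\Gamma_{\mathcal{G}}(G)$ has vertex set $G$ and an edge from $g$ to $ga$ labelled $a$ for each $g\in G$, $a\in\mathcal{G}$; each edge is isometric to the unit interval and $d_{\mathcal{G}}$ is the induced path metric on $\Gamma$. For $x\in\Gamma$ put $\ell_{\mathcal{G}}(x)=d_{\mathcal{G}}(1,x)$, and let $B(r)=\{x\in\Gamma : \ell_{\mathcal{G}}(x)\le r\}$. Almost convexity: $G$ is almost convex $(m)$ with respect to $\mathcal{G}$ if there is a constant $K(m)$ such that whenever $n\ge 0$ is an integer and $g,g'\in G$ satisfy $\ell_{\mathcal{G}}(g)=\ell_{\mathcal{G}}(g')=n$ and $d_{\mathcal{G}}(g,g')\le m$, there is an edge path in $\Gamma$ from $g$ to $g'$ which lies inside $B(n)$ and has length at most $K(m)$. $G$ is almost convex with respect to $\mathcal{G}$ if it is almost convex $(m)$ with respect to $\mathcal{G}$ for all $m$. Word hyperbolic: a finitely generated group $H$ is word hyperbolic if for some (equivalently, every) finite generating set there is a constant $\delta$ such that in the corresponding Cayley graph each side of every geodesic triangle lies in the $\delta$-neighborhood of the union of the other two sides. *)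

theory Defs
  imports Complex_Main "HOL-Algebra.Elementary_Groups"
begin

section \<open>Generating sets and the Cayley graph\<close>

definition generating_set :: "('a, 'c) monoid_scheme \<Rightarrow> 'a set \<Rightarrow> bool" where
  "generating_set G S \<longleftrightarrow>
     finite S \<and> S \<subseteq> carrier G \<and> (\<forall>a\<in>S. inv\<^bsub>G\<^esub> a \<in> S) \<and> generate G S = carrier G"

text \<open>
  Points of the geometric realisation: vertices, and the interior points of the edge labelled
  \<open>a\<close> from \<open>g\<close> to \<open>g a\<close>, where the parameter lies strictly between \<open>0\<close> and \<open>1\<close>.
  There is one edge for each pair \<open>(g, a)\<close>; in particular the edge \<open>(g a, a\<^sup>-\<^sup>1)\<close> is a
  different edge joining the same two vertices as \<open>(g, a)\<close>.
\<close>

datatype 'a cayley_point = Vertex 'a | Interior 'a 'a real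

definition edge_point :: "('a, 'c) monoid_scheme \<Rightarrow> 'a \<Rightarrow> 'a \<Rightarrow> real \<Rightarrow> 'a cayley_point" where
  "edge_point G g a t =
     (if t = 0 then Vertex g else if t = 1 then Vertex (g \<otimes>\<^bsub>G\<^esub> a) else Interior g a t)"

definition cayley_edge :: "('a, 'c) monoid_scheme \<Rightarrow> 'a \<Rightarrow> 'a \<Rightarrow> 'a cayley_point set" where
  "cayley_edge G g a = edge_point G g a ` {0..1}"

definition cayley_graph :: "('a, 'c) monoid_scheme \<Rightarrow> 'a set \<Rightarrow> 'a cayley_point set" where
  "cayley_graph G S = Vertex ` carrier G \<union> (\<Union>g\<in>carrier G. \<Union>a\<in>S. cayley_edge G g a)"

text \<open>
  The path metric of a metric graph: \<open>cayley_path G S x y L\<close> says that \<open>x\<close> is joined to \<open>y\<close> by a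
  concatenation of finitely many segments, each contained in one edge, of total length \<open>L\<close>.
\<close>

inductive cayley_path ::
  "('a, 'c) monoid_scheme \<Rightarrow> 'a set \<Rightarrow> 'a cayley_point \<Rightarrow> 'a cayley_point \<Rightarrow> real \<Rightarrow> bool"
  for G S x where
  refl: "x \<in> cayley_graph G S \<Longrightarrow> cayley_path G S x x 0"
| step: "\<lbrakk>cayley_path G S x (edge_point G g a s) L; g \<in> carrier G; a \<in> S; s \<in> {0..1}; t \<in> {0..1}\<rbrakk>
          \<Longrightarrow> cayley_path G S x (edge_point G g a t) (L + \<bar>s - t\<bar>)"

definition cayley_dist ::
  "('a, 'c) monoid_scheme \<Rightarrow> 'a set \<Rightarrow> 'a cayley_point \<Rightarrow> 'a cayley_point \<Rightarrow> real" where
  "cayley_dist G S x y = Inf {L. cayley_path G S x y L}"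

definition cayley_length :: "('a, 'c) monoid_scheme \<Rightarrow> 'a set \<Rightarrow> 'a cayley_point \<Rightarrow> real" where
  "cayley_length G S x = cayley_dist G S (Vertex \<one>\<^bsub>G\<^esub>) x"

definition cayley_ball :: "('a, 'c) monoid_scheme \<Rightarrow> 'a set \<Rightarrow> real \<Rightarrow> 'a cayley_point set" where
  "cayley_ball G S r = {x \<in> cayley_graph G S. cayley_length G S x \<le> r}"


section \<open>Almost convexity\<close>

text \<open>
  \<open>edge_path_in G S U g h k\<close>: there is an edge path with \<open>k\<close> edges from \<open>g\<close> to \<open>h\<close>, all of whose
  points (not only its vertices) lie in \<open>U\<close>. An edge may be traversed in either direction.
\<close>

inductive edge_path_in ::
  "('a, 'c) monoid_scheme \<Rightarrow> 'a set \<Rightarrow> 'a cayley_point set \<Rightarrow> 'a \<Rightarrow> 'a \<Rightarrow> nat \<Rightarrow> bool"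
  for G S U g where
  trivial: "\<lbrakk>g \<in> carrier G; Vertex g \<in> U\<rbrakk> \<Longrightarrow> edge_path_in G S U g g 0"
| forward: "\<lbrakk>edge_path_in G S U g h k; a \<in> S; cayley_edge G h a \<subseteq> U\<rbrakk>
             \<Longrightarrow> edge_path_in G S U g (h \<otimes>\<^bsub>G\<^esub> a) (Suc k)"
| backward: "\<lbrakk>edge_path_in G S U g (h \<otimes>\<^bsub>G\<^esub> a) k; h \<in> carrier G; a \<in> S; cayley_edge G h a \<subseteq> U\<rbrakk>
             \<Longrightarrow> edge_path_in G S U g h (Suc k)"

definition almost_convex_at :: "('a, 'c) monoid_scheme \<Rightarrow> 'a set \<Rightarrow> nat \<Rightarrow> bool" where
  "almost_convex_at G S m \<longleftrightarrow>
     (\<exists>K::nat. \<forall>n::nat. \<forall>g\<in>carrier G. \<forall>g'\<in>carrier G.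
        cayley_length G S (Vertex g) = real n \<and> cayley_length G S (Vertex g') = real n \<and>
        cayley_dist G S (Vertex g) (Vertex g') \<le> real m \<longrightarrow>
        (\<exists>k\<le>K. edge_path_in G S (cayley_ball G S (real n)) g g' k))"

definition almost_convex :: "('a, 'c) monoid_scheme \<Rightarrow> 'a set \<Rightarrow> bool" where
  "almost_convex G S \<longleftrightarrow> (\<forall>m. almost_convex_at G S m)"


section \<open>Word hyperbolic groups\<close>

definition geodesic_segment ::
  "'p set \<Rightarrow> ('p \<Rightarrow> 'p \<Rightarrow> real) \<Rightarrow> 'p \<Rightarrow> 'p \<Rightarrow> 'p set \<Rightarrow> bool" where
  "geodesic_segment X d x y A \<longleftrightarrow>
     (\<exists>L \<gamma>. 0 \<le> L \<and> \<gamma> ` {0..L} \<subseteq> X \<and> \<gamma> 0 = x \<and> \<gamma> L = y \<and>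
            (\<forall>s\<in>{0..L}. \<forall>t\<in>{0..L}. d (\<gamma> s) (\<gamma> t) = \<bar>s - t\<bar>) \<and> A = \<gamma> ` {0..L})"

definition neighborhood ::
  "'p set \<Rightarrow> ('p \<Rightarrow> 'p \<Rightarrow> real) \<Rightarrow> real \<Rightarrow> 'p set \<Rightarrow> 'p set" where
  "neighborhood X d \<delta> A = {p \<in> X. \<exists>q\<in>A. d p q \<le> \<delta>}"

definition thin_triangles :: "'p set \<Rightarrow> ('p \<Rightarrow> 'p \<Rightarrow> real) \<Rightarrow> real \<Rightarrow> bool" where
  "thin_triangles X d \<delta> \<longleftrightarrow>
     (\<forall>x y z A B C.
        geodesic_segment X d x y A \<and> geodesic_segment X d y z B \<and> geodesic_segment X d z x C \<longrightarrow>
        A \<subseteq> neighborhood X d \<delta> (B \<union> C) \<and>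
        B \<subseteq> neighborhood X d \<delta> (C \<union> A) \<and>
        C \<subseteq> neighborhood X d \<delta> (A \<union> B))"

definition word_hyperbolic :: "('a, 'c) monoid_scheme \<Rightarrow> bool" where
  "word_hyperbolic H \<longleftrightarrow>
     group H \<and>
     (\<exists>S. generating_set H S \<and>
          (\<exists>\<delta>. thin_triangles (cayley_graph H S) (cayley_dist H S) \<delta>))"


section \<open>Short exact sequences\<close>

text \<open>
  The library's \<open>short_exact_sequence\<close> requires the three groups to have the same element type,
  which would rule out \<open>integer_group\<close> as the kernel of an arbitrary extension.
\<close>

definition short_exact ::
  "('k, 'c) monoid_scheme \<Rightarrow> ('a, 'd) monoid_scheme \<Rightarrow> ('b, 'e) monoid_scheme \<Rightarrow>
   ('k \<Rightarrow> 'a) \<Rightarrow> ('a \<Rightarrow> 'b) \<Rightarrow> bool" where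
  "short_exact N G H f p \<longleftrightarrow>
     group N \<and> group G \<and> group H \<and>
     f \<in> mon N G \<and> p \<in> epi G H \<and> f ` carrier N = kernel G H p"

end

theory Submission
  imports Defs
begin

text \<open>
  Let \<open>L\<close> be a finite symmetric set of lifts of the generators of \<open>H\<close>, and take as generators of
  \<open>G\<close> the set \<open>L\<close> together with the kernel elements \<open>f c\<close>, \<open>\<bar>c\<bar> \<le> M\<close>, for a large \<open>M\<close>. Since the
  kernel is normal, every element is \<open>f T \<otimes> val Q\<close> with a word \<open>Q\<close> in \<open>L\<close>, and its length is at
  most \<open>n\<close> iff some such expression has weight \<open>M |Q| + \<bar>T\<bar> \<le> M n\<close>. Hyperbolicity of \<open>H\<close> gives a
  linear isoperimetric inequality: a word \<open>Q\<close> that is trivial in \<open>H\<close> equals \<open>f c\<close> with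
  \<open>\<bar>c\<bar> \<le> E |Q|\<close>. If \<open>M\<close> is large compared to \<open>E\<close>, then the word \<open>Q\<close> of an expression of least
  weight projects to a quasigeodesic of \<open>H\<close> that is geodesic at a prescribed scale.

  Let \<open>g\<close> and \<open>g'\<close> be at distance at most \<open>m\<close> on the sphere of radius \<open>n\<close>, with words \<open>P\<close> and
  \<open>P'\<close>. If \<open>P\<close> has at least \<open>j\<close> letters, go back \<open>j\<close> letters along \<open>P\<close>; the point reached is
  close in \<open>H\<close> to a point of \<open>P'\<close>, and the two corresponding elements of \<open>G\<close> differ in the
  kernel by at most a constant plus a small multiple of \<open>M j\<close>. So for \<open>j\<close> large in terms of
  \<open>m\<close> they are joined by a path of length at most \<open>j\<close>, which stays in the ball. If both words
  have fewer than \<open>j\<close> letters and \<open>n\<close> is large, then the kernel parts of \<open>g\<close> and \<open>g'\<close> are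
  large of the same sign, and one first moves down in the kernel direction.
\<close>

section \<open>Word metrics and Cayley graphs\<close>

definition word_val :: "('a, 'c) monoid_scheme \<Rightarrow> 'a list \<Rightarrow> 'a" where
  "word_val G ws = foldr (mult G) ws (one G)"

definition word_length :: "('a, 'c) monoid_scheme \<Rightarrow> 'a set \<Rightarrow> 'a \<Rightarrow> nat" where
  "word_length G S g = (LEAST n. \<exists>ws\<in>lists S. length ws = n \<and> word_val G ws = g)"

definition word_dist :: "('a, 'c) monoid_scheme \<Rightarrow> 'a set \<Rightarrow> 'a \<Rightarrow> 'a \<Rightarrow> nat" where
  "word_dist G S x y = word_length G S (inv\<^bsub>G\<^esub> x \<otimes>\<^bsub>G\<^esub> y)"

context group
begin

lemma word_val_Nil [simp]: "word_val G [] = \<one>"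
  by (simp add: word_val_def)

lemma word_val_Cons [simp]: "word_val G (a # ws) = a \<otimes> word_val G ws"
  by (simp add: word_val_def)

lemma word_val_closed [simp]: "set ws \<subseteq> carrier G \<Longrightarrow> word_val G ws \<in> carrier G"
  by (induction ws) auto

lemma word_val_append:
  "set us \<subseteq> carrier G \<Longrightarrow> set vs \<subseteq> carrier G \<Longrightarrow>
     word_val G (us @ vs) = word_val G us \<otimes> word_val G vs"
  by (induction us) (auto simp: m_assoc)

lemma mult_inv_cancel [simp]:
  assumes "x \<in> carrier G" "y \<in> carrier G"
  shows "x \<otimes> (inv x \<otimes> y) = y" "inv x \<otimes> (x \<otimes> y) = y"
  using assms by (simp_all flip: m_assoc)

lemma word_val_inverse:
  "set ws \<subseteq> carrier G \<Longrightarrow> word_val G (rev (map (m_inv G) ws)) = inv (word_val G ws)"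
proof (induction ws)
  case (Cons a ws)
  have "set (rev (map (m_inv G) ws)) \<subseteq> carrier G"
    using Cons.prems by auto
  with Cons show ?case
    by (simp add: word_val_append inv_mult_group)
qed auto

end

section \<open>Word length and word metric of a generated group\<close>

locale generated_group = group G for G (structure) +
  fixes S
  assumes gen: "generating_set G S"
begin

abbreviation "val \<equiv> word_val G"
abbreviation "wlen \<equiv> word_length G S"
abbreviation "wd \<equiv> word_dist G S"

lemma S_carrier: "S \<subseteq> carrier G" and S_inv: "a \<in> S \<Longrightarrow> inv a \<in> S"
  using gen by (auto simp: generating_set_def)

lemma lists_carrier: "ws \<in> lists S \<Longrightarrow> set ws \<subseteq> carrier G"
  using S_carrier by auto

lemma word_exists: "g \<in> carrier G \<Longrightarrow> \<exists>ws\<in>lists S. val ws = g"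
proof -
  assume "g \<in> carrier G"
  then have "g \<in> generate G S" using gen by (simp add: generating_set_def)
  then show ?thesis
  proof induction
    case one
    show ?case by (rule bexI[of _ "[]"]) auto
  next
    case (incl h)
    then show ?case using S_carrier by (intro bexI[of _ "[h]"]) auto
  next
    case (inv h)
    then show ?case using S_carrier S_inv by (intro bexI[of _ "[inv h]"]) auto
  next
    case (eng h1 h2)
    then obtain us vs where "us \<in> lists S" "val us = h1" "vs \<in> lists S" "val vs = h2" by auto
    then show ?case
      using lists_carrier by (intro bexI[of _ "us @ vs"]) (auto simp: word_val_append)
  qed
qed

lemma wlen_word:
  assumes "g \<in> carrier G"
  obtains ws where "ws \<in> lists S" "length ws = wlen g" "val ws = g"
proof -
  obtain us where "us \<in> lists S" "val us = g" using word_exists[OF assms] by auto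
  then have "\<exists>ws\<in>lists S. length ws = length us \<and> val ws = g" by auto
  then have "\<exists>ws\<in>lists S. length ws = wlen g \<and> val ws = g"
    unfolding word_length_def by (rule LeastI)
  then show ?thesis using that by auto
qed

lemma wlen_le: "ws \<in> lists S \<Longrightarrow> wlen (val ws) \<le> length ws"
  unfolding word_length_def by (rule Least_le) auto

lemma wlen_one [simp]: "wlen \<one> = 0"
  using wlen_le[of "[]"] by simp

lemma wlen_mult:
  assumes "g \<in> carrier G" "h \<in> carrier G"
  shows "wlen (g \<otimes> h) \<le> wlen g + wlen h"
proof -
  obtain us where u: "us \<in> lists S" "length us = wlen g" "val us = g" using wlen_word assms by metis
  obtain vs where v: "vs \<in> lists S" "length vs = wlen h" "val vs = h" using wlen_word assms by metis
  have "wlen (val (us @ vs)) \<le> length (us @ vs)" by (rule wlen_le) (use u v in auto)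
  then show ?thesis using u v lists_carrier by (simp add: word_val_append)
qed

lemma inverse_word_lists: "ws \<in> lists S \<Longrightarrow> rev (map (m_inv G) ws) \<in> lists S"
  using S_inv by auto

lemma wlen_inv_le: "g \<in> carrier G \<Longrightarrow> wlen (inv g) \<le> wlen g"
proof -
  assume g: "g \<in> carrier G"
  obtain us where u: "us \<in> lists S" "length us = wlen g" "val us = g" using wlen_word g by metis
  have "wlen (val (rev (map (m_inv G) us))) \<le> length (rev (map (m_inv G) us))"
    by (rule wlen_le[OF inverse_word_lists[OF u(1)]])
  then show ?thesis using u lists_carrier by (simp add: word_val_inverse)
qed

lemma wlen_inv [simp]: "g \<in> carrier G \<Longrightarrow> wlen (inv g) = wlen g"
  using wlen_inv_le[of g] wlen_inv_le[of "inv g"] by simp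

lemma wd_self [simp]: "x \<in> carrier G \<Longrightarrow> wd x x = 0"
  by (simp add: word_dist_def)

lemma wd_one [simp]: "x \<in> carrier G \<Longrightarrow> wd \<one> x = wlen x"
  by (simp add: word_dist_def)

lemma wd_commute: "x \<in> carrier G \<Longrightarrow> y \<in> carrier G \<Longrightarrow> wd x y = wd y x"
  using wlen_inv[of "inv x \<otimes> y"] by (simp add: word_dist_def inv_mult_group)

lemma wd_triangle:
  assumes "x \<in> carrier G" "y \<in> carrier G" "z \<in> carrier G"
  shows "wd x z \<le> wd x y + wd y z"
proof -
  have "inv x \<otimes> z = (inv x \<otimes> y) \<otimes> (inv y \<otimes> z)"
    using assms by (simp add: m_assoc)
  then show ?thesis unfolding word_dist_def using assms by (simp add: wlen_mult)
qed

lemma wd_left_cancel: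
  assumes "g \<in> carrier G" "x \<in> carrier G" "y \<in> carrier G"
  shows "wd (g \<otimes> x) (g \<otimes> y) = wd x y"
proof -
  have "inv (g \<otimes> x) \<otimes> (g \<otimes> y) = inv x \<otimes> y"
    using assms by (simp add: m_assoc inv_mult_group)
  then show ?thesis by (simp add: word_dist_def)
qed

lemma wd_mult_right: "x \<in> carrier G \<Longrightarrow> g \<in> carrier G \<Longrightarrow> wd x (x \<otimes> g) = wlen g"
  using wd_left_cancel[of x \<one> g] by simp

lemma wlen_le_add_wd: "x \<in> carrier G \<Longrightarrow> y \<in> carrier G \<Longrightarrow> wlen y \<le> wlen x + wd x y"
  using wd_triangle[of \<one> x y] by simp

lemma wd_word:
  assumes "x \<in> carrier G" "y \<in> carrier G"
  obtains ws where "ws \<in> lists S" "length ws = wd x y" "x \<otimes> val ws = y"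
proof -
  obtain ws where "ws \<in> lists S" "length ws = wd x y" "val ws = inv x \<otimes> y"
    using wlen_word[of "inv x \<otimes> y"] assms unfolding word_dist_def by auto
  then show ?thesis using assms by (intro that[of ws]) auto
qed

lemma wd_generator: "x \<in> carrier G \<Longrightarrow> a \<in> S \<Longrightarrow> wd x (x \<otimes> a) \<le> 1"
  using wlen_le[of "[a]"] S_carrier by (auto simp: wd_mult_right)

subsection \<open>The path metric on vertices\<close>

lemma edge_point_in_graph:
  "g \<in> carrier G \<Longrightarrow> a \<in> S \<Longrightarrow> t \<in> {0..1} \<Longrightarrow> edge_point G g a t \<in> cayley_graph G S"
  unfolding cayley_graph_def cayley_edge_def by blast

lemma edge_point_0 [simp]: "edge_point G g a 0 = Vertex g"
  and edge_point_1 [simp]: "edge_point G g a 1 = Vertex (g \<otimes> a)"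
  by (simp_all add: edge_point_def)

lemma cayley_path_in_graph:
  assumes "cayley_path G S x y L" shows "x \<in> cayley_graph G S" "y \<in> cayley_graph G S"
  using assms by (induction) (auto simp: edge_point_in_graph)

lemma cayley_path_trans:
  assumes "cayley_path G S y z L'" "cayley_path G S x y L"
  shows "cayley_path G S x z (L + L')"
  using assms
proof (induction)
  case (step g a s L' t)
  then show ?case using cayley_path.step[of G S x g a s "L + L'" t] by (simp add: add.assoc)
qed auto

lemma cayley_path_segment:
  assumes "g \<in> carrier G" "a \<in> S" "s \<in> {0..1}" "t \<in> {0..1}"
  shows "cayley_path G S (edge_point G g a s) (edge_point G g a t) \<bar>s - t\<bar>"
  using cayley_path.step[OF cayley_path.refl assms] edge_point_in_graph assms by auto

lemma cayley_path_sym: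
  "cayley_path G S x y L \<Longrightarrow> cayley_path G S y x L"
proof (induction rule: cayley_path.induct)
  case (step g a s L t)
  then show ?case
    using cayley_path_trans[OF step.IH cayley_path_segment[of g a t s]]
    by (simp add: abs_minus_commute add.commute)
qed (auto intro: cayley_path.refl)

lemma cayley_path_nonneg: "cayley_path G S x y L \<Longrightarrow> 0 \<le> L"
  by (induction rule: cayley_path.induct) auto

lemma cayley_path_word:
  assumes "x \<in> carrier G" "ws \<in> lists S"
  shows "cayley_path G S (Vertex x) (Vertex (x \<otimes> val ws)) (real (length ws))"
  using assms
proof (induction ws arbitrary: x)
  case Nil
  then show ?case by (auto simp: cayley_graph_def intro!: cayley_path.refl)
next
  case (Cons a ws)
  have a: "a \<in> S" "a \<in> carrier G" using Cons.prems S_carrier by auto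
  have "cayley_path G S (Vertex x) (Vertex (x \<otimes> a)) 1"
    using cayley_path_segment[of x a 0 1] a Cons.prems by simp
  moreover have "cayley_path G S (Vertex (x \<otimes> a)) (Vertex (x \<otimes> a \<otimes> val ws)) (real (length ws))"
    using Cons.IH[of "x \<otimes> a"] Cons.prems a by simp
  ultimately have "cayley_path G S (Vertex x) (Vertex (x \<otimes> a \<otimes> val ws)) (1 + real (length ws))"
    using cayley_path_trans by blast
  then show ?case using Cons.prems a lists_carrier[of ws] by (simp add: m_assoc)
qed

lemma cayley_path_vertices:
  assumes "x \<in> carrier G" "y \<in> carrier G"
  shows "cayley_path G S (Vertex x) (Vertex y) (real (wd x y))"
  using wd_word[OF assms] cayley_path_word[OF assms(1)] by metis

text \<open>The function \<open>pot\<close> below is the distance to the vertex \<open>x\<close>; being 1-Lipschitz along edges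
  it bounds the length of every path from below.\<close>

lemma cayley_path_vertex_length_ge:
  assumes "cayley_path G S (Vertex x) q L" "q = Vertex y" "x \<in> carrier G" "y \<in> carrier G"
  shows "real (wd x y) \<le> L"
proof -
  define pot where "pot q = (case q of Vertex g \<Rightarrow> real (wd x g)
      | Interior g a t \<Rightarrow> min (wd x g + t) (wd x (g \<otimes> a) + 1 - t))" for q
  \<comment> \<open>The formula also covers the vertices at \<open>t = 0\<close> and
    \<open>t = 1\<close>: the distances of adjacent vertices to \<open>x\<close> differ by at most
    one, so the right branch of the minimum wins there.\<close>
  have pot_edge: "pot (edge_point G g a t) = min (wd x g + t) (wd x (g \<otimes> a) + 1 - t)"
    if "g \<in> carrier G" "a \<in> S" "t \<in> {0..1}" for g a and t :: real
  proof -
    have "a \<in> carrier G" using that S_carrier by auto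
    then have "wd x (g \<otimes> a) \<le> wd x g + 1" "wd x g \<le> wd x (g \<otimes> a) + 1"
      using wd_triangle[of x g "g \<otimes> a"] wd_triangle[of x "g \<otimes> a" g] wd_generator[of g a] that
        wd_commute[of g "g \<otimes> a"] assms by auto
    then show ?thesis by (auto simp: pot_def edge_point_def)
  qed
  have "pot q \<le> L"
    using assms(1)
  proof (induction rule: cayley_path.induct)
    case refl
    then show ?case by (simp add: pot_def assms)
  next
    case (step g a s L t)
    then show ?case using pot_edge[of g a s] pot_edge[of g a t] by auto
  qed
  then show ?thesis by (simp add: pot_def assms)
qed

lemma bdd_below_path_lengths: "bdd_below {L. cayley_path G S x y L}"
  by (rule bdd_belowI[of _ 0]) (use cayley_path_nonneg in auto)

lemma cayley_dist_le: "cayley_path G S x y L \<Longrightarrow> cayley_dist G S x y \<le> L"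
  unfolding cayley_dist_def by (rule cInf_lower) (auto simp: bdd_below_path_lengths)

lemma cayley_dist_vertices:
  assumes "x \<in> carrier G" "y \<in> carrier G"
  shows "cayley_dist G S (Vertex x) (Vertex y) = real (wd x y)"
  unfolding cayley_dist_def
  by (rule cInf_eq_minimum)
    (use cayley_path_vertices[OF assms] cayley_path_vertex_length_ge assms in auto)

lemma cayley_length_vertex:
  "x \<in> carrier G \<Longrightarrow> cayley_length G S (Vertex x) = real (wlen x)"
  by (simp add: cayley_length_def cayley_dist_vertices)

lemma cayley_length_edge_point_le:
  fixes t :: real
  assumes "g \<in> carrier G" "a \<in> S" "t \<in> {0..1}"
  shows "cayley_length G S (edge_point G g a t) \<le> wlen g + t"
    "cayley_length G S (edge_point G g a t) \<le> wlen (g \<otimes> a) + 1 - t"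
proof -
  have ga: "g \<otimes> a \<in> carrier G" using assms S_carrier by auto
  have "cayley_path G S (Vertex \<one>) (edge_point G g a t) (wlen g + \<bar>0 - t\<bar>)"
    by (rule cayley_path.step) (use cayley_path_vertices[of \<one> g] assms in auto)
  from cayley_dist_le[OF this] show "cayley_length G S (edge_point G g a t) \<le> wlen g + t"
    using assms by (simp add: cayley_length_def)
  have "cayley_path G S (Vertex \<one>) (edge_point G g a t) (wlen (g \<otimes> a) + \<bar>1 - t\<bar>)"
    by (rule cayley_path.step) (use cayley_path_vertices[of \<one> "g \<otimes> a"] ga assms in auto)
  from cayley_dist_le[OF this] show "cayley_length G S (edge_point G g a t) \<le> wlen (g \<otimes> a) + 1 - t"
    using assms by (simp add: cayley_length_def)
qed

subsection \<open>Edge paths in balls\<close>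

abbreviation "ball n \<equiv> cayley_ball G S (real n)"

lemma vertex_in_ball: "x \<in> carrier G \<Longrightarrow> wlen x \<le> n \<Longrightarrow> Vertex x \<in> ball n"
  by (simp add: cayley_ball_def cayley_length_vertex cayley_graph_def)

text \<open>Almost convexity asks for whole edges in the ball, not only for their vertices. Every
  point of an edge lies within 1 of the starting vertex, whose length is at most
  \<open>n - 1\<close> here.\<close>

lemma edge_in_ball:
  assumes "g \<in> carrier G" "a \<in> S" "wlen g < n"
  shows "cayley_edge G g a \<subseteq> ball n"
proof
  fix q assume "q \<in> cayley_edge G g a"
  then obtain t where t: "t \<in> {0..1}" "q = edge_point G g a t" by (auto simp: cayley_edge_def)
  have "real (wlen g) + 1 \<le> n" using assms(3) by linarith
  then show "q \<in> ball n"
    using t cayley_length_edge_point_le(1)[OF assms(1,2) t(1)] edge_point_in_graph[OF assms(1,2) t(1)]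
    by (auto simp: cayley_ball_def)
qed

lemma edge_path_carrier: "edge_path_in G S U g h k \<Longrightarrow> g \<in> carrier G \<and> h \<in> carrier G"
  by (induction rule: edge_path_in.induct) (use S_carrier in auto)

lemma edge_path_trans:
  "edge_path_in G S U h l k' \<Longrightarrow> edge_path_in G S U g h k \<Longrightarrow> edge_path_in G S U g l (k + k')"
  by (induction rule: edge_path_in.induct)
    (auto intro: edge_path_in.intros)

lemma edge_path_edge:
  assumes "h \<in> carrier G" "a \<in> S" "cayley_edge G h a \<subseteq> U"
  shows "edge_path_in G S U h (h \<otimes> a) 1" "edge_path_in G S U (h \<otimes> a) h 1"
proof -
  have a: "a \<in> carrier G" using assms S_carrier by auto
  have "Vertex h \<in> cayley_edge G h a" unfolding cayley_edge_def
    by (rule image_eqI[of _ _ 0]) auto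
  moreover have "Vertex (h \<otimes> a) \<in> cayley_edge G h a" unfolding cayley_edge_def
    by (rule image_eqI[of _ _ 1]) auto
  ultimately have "Vertex h \<in> U" "Vertex (h \<otimes> a) \<in> U" using assms by auto
  then show "edge_path_in G S U h (h \<otimes> a) 1" "edge_path_in G S U (h \<otimes> a) h 1"
    using edge_path_in.forward[of G S U h h 0 a] edge_path_in.backward[of G S U "h \<otimes> a" h a 0]
      edge_path_in.trivial[of h G U S] edge_path_in.trivial[of "h \<otimes> a" G U S] assms a by auto
qed

lemma edge_path_sym: "edge_path_in G S U g h k \<Longrightarrow> edge_path_in G S U h g k"
proof (induction rule: edge_path_in.induct)
  case (forward h k a)
  then show ?case
    using edge_path_trans[OF forward.IH edge_path_edge(2)[of h a U]] edge_path_carrier by auto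
next
  case (backward h a k)
  then show ?case
    using edge_path_trans[OF backward.IH edge_path_edge(1)[of h a U]] by auto
qed (auto intro: edge_path_in.trivial)

lemma edge_path_word:
  assumes "x \<in> carrier G" "ws \<in> lists S" "wlen x + length ws \<le> n"
  shows "edge_path_in G S (ball n) x (x \<otimes> val ws) (length ws)"
  using assms
proof (induction ws arbitrary: x)
  case Nil
  then show ?case by (auto intro!: edge_path_in.trivial vertex_in_ball)
next
  case (Cons a ws)
  have a: "a \<in> S" "a \<in> carrier G" using Cons.prems S_carrier by auto
  have "wlen (x \<otimes> a) \<le> wlen x + 1"
    using wlen_le_add_wd[of x "x \<otimes> a"] wd_generator[of x a] Cons.prems a by simp
  then have "edge_path_in G S (ball n) (x \<otimes> a) (x \<otimes> a \<otimes> val ws) (length ws)"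
    using Cons.IH[of "x \<otimes> a"] Cons.prems a by simp
  moreover have "edge_path_in G S (ball n) x (x \<otimes> a) 1"
    by (rule edge_path_edge) (use Cons.prems a edge_in_ball in auto)
  ultimately have "edge_path_in G S (ball n) x (x \<otimes> a \<otimes> val ws) (1 + length ws)"
    using edge_path_trans by blast
  then show ?case using Cons.prems a lists_carrier[of ws] by (simp add: m_assoc)
qed

text \<open>All later paths are kept in the ball this way: a geodesic that starts at depth at least
  its own length below the sphere cannot leave the ball. Reversed, it leads from the sphere down to
  the deeper point.\<close>

lemma edge_path_in_ball:
  assumes "x \<in> carrier G" "y \<in> carrier G" "wlen x + wd x y \<le> n"
  shows "edge_path_in G S (ball n) x y (wd x y)" "edge_path_in G S (ball n) y x (wd x y)"
proof -
  obtain ws where "ws \<in> lists S" "length ws = wd x y" "x \<otimes> val ws = y"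
    using wd_word assms by metis
  then show "edge_path_in G S (ball n) x y (wd x y)"
    using edge_path_word[of x ws n] assms by auto
  then show "edge_path_in G S (ball n) y x (wd x y)" by (rule edge_path_sym)
qed

lemma almost_convex_atI:
  assumes "\<And>n g g'. g \<in> carrier G \<Longrightarrow> g' \<in> carrier G \<Longrightarrow> wlen g = n \<Longrightarrow> wlen g' = n \<Longrightarrow> wd g g' \<le> m
      \<Longrightarrow> \<exists>k\<le>K. edge_path_in G S (ball n) g g' k"
  shows "almost_convex_at G S m"
  unfolding almost_convex_at_def
  by (rule exI[of _ K]) (use assms in \<open>auto simp: cayley_length_vertex cayley_dist_vertices\<close>)

subsection \<open>Thin triangles in terms of vertices\<close>

text \<open>The integer part of \<open>s\<close> selects the edge and the fractional part the
  position on it. At \<open>s = length ws\<close> the list index is out of range, harmlessly, since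
  \<open>edge_point\<close> ignores its label at parameter 0.\<close>

definition word_path :: "'a \<Rightarrow> 'a list \<Rightarrow> real \<Rightarrow> 'a cayley_point" where
  "word_path x ws s = edge_point G (x \<otimes> val (take (nat \<lfloor>s\<rfloor>) ws)) (ws ! nat \<lfloor>s\<rfloor>) (frac s)"

lemma word_path_vertex: "word_path x ws (real i) = Vertex (x \<otimes> val (take i ws))"
  by (simp add: word_path_def frac_def)

lemma take_lists: "ws \<in> lists A \<Longrightarrow> take i ws \<in> lists A"
  and drop_lists: "ws \<in> lists A \<Longrightarrow> drop i ws \<in> lists A"
  by (auto dest: in_set_takeD in_set_dropD)

lemma vertex_Suc:
  assumes "x \<in> carrier G" "ws \<in> lists S" "i < length ws"
  shows "x \<otimes> val (take (Suc i) ws) = x \<otimes> val (take i ws) \<otimes> ws ! i"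
proof -
  have "set (take i ws) \<subseteq> carrier G" "ws ! i \<in> carrier G"
    using lists_carrier[OF take_lists[OF assms(2)]] lists_carrier[OF assms(2)] assms(3) by auto
  then show ?thesis using assms(1,3) by (simp add: take_Suc_conv_app_nth word_val_append m_assoc)
qed

text \<open>At \<open>t = 1\<close> the floor already selects the next edge; both descriptions give
  the common vertex.\<close>

lemma word_path_edge:
  assumes "x \<in> carrier G" "ws \<in> lists S" "i < length ws" "t \<in> {0..1}"
  shows "word_path x ws (real i + t) = edge_point G (x \<otimes> val (take i ws)) (ws ! i) t"
proof (cases "t = 1")
  case True
  have "word_path x ws (real i + t) = Vertex (x \<otimes> val (take (Suc i) ws))"
    using word_path_vertex[of x ws "Suc i"] True by (simp add: add.commute)
  then show ?thesis
    using True vertex_Suc[OF assms(1-3)] by simp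
next
  case False
  then have "\<lfloor>real i + t\<rfloor> = int i" "frac (real i + t) = t"
    using assms(4) by (auto simp: floor_eq_iff frac_def)
  then show ?thesis by (simp add: word_path_def)
qed

lemma word_path_segment:
  assumes "x \<in> carrier G" "ws \<in> lists S" "i < length ws"
    "s \<in> {real i..real i + 1}" "t \<in> {real i..real i + 1}"
  shows "cayley_path G S (word_path x ws s) (word_path x ws t) \<bar>s - t\<bar>"
proof -
  have "x \<otimes> val (take i ws) \<in> carrier G"
    using assms lists_carrier[OF take_lists[OF assms(2)]] by simp
  moreover have "ws ! i \<in> S" using assms by auto
  ultimately show ?thesis
    using cayley_path_segment[of "x \<otimes> val (take i ws)" "ws ! i" "s - real i" "t - real i"]
      word_path_edge[OF assms(1-3), of "s - real i"] word_path_edge[OF assms(1-3), of "t - real i"]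
      assms(4,5) by simp
qed

lemma word_path_le:
  assumes "x \<in> carrier G" "ws \<in> lists S" "0 \<le> s" "s \<le> t" "t \<le> real (length ws)"
  shows "cayley_path G S (word_path x ws s) (word_path x ws t) (t - s)"
proof -
  \<comment> \<open>Induction on a bound \<open>k\<close> for \<open>t\<close>, adding one edge at a
    time; if \<open>s\<close> lies in the same edge as \<open>t\<close>, one segment
    suffices.\<close>
  have "s \<le> t \<Longrightarrow> t \<le> real k \<Longrightarrow> t \<le> real (length ws) \<Longrightarrow>
      cayley_path G S (word_path x ws s) (word_path x ws t) (t - s)" for k
  proof (induction k arbitrary: t)
    case 0
    then have "s = 0" "t = 0" using assms by auto
    then show ?case using assms word_path_vertex[of x ws 0]
      by (auto simp: cayley_graph_def intro!: cayley_path.refl)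
  next
    case (Suc k)
    show ?case
    proof (cases "t \<le> k")
      case False
      then have k: "k < length ws" using Suc.prems by linarith
      show ?thesis
      proof (cases "s \<le> k")
        case True
        have "cayley_path G S (word_path x ws s) (word_path x ws k) (k - s)"
          by (rule Suc.IH) (use True k in auto)
        moreover have "cayley_path G S (word_path x ws k) (word_path x ws t) \<bar>k - t\<bar>"
          by (rule word_path_segment[OF assms(1,2) k]) (use False Suc.prems in auto)
        ultimately have "cayley_path G S (word_path x ws s) (word_path x ws t) ((k - s) + \<bar>k - t\<bar>)"
          using cayley_path_trans by blast
        then show ?thesis using False by simp
      next
        case False
        have "cayley_path G S (word_path x ws s) (word_path x ws t) \<bar>s - t\<bar>"
          by (rule word_path_segment[OF assms(1,2) k]) (use False Suc.prems in auto)
        then show ?thesis using Suc.prems by simp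
      qed
    qed (use Suc in auto)
  qed
  from this[of "length ws"] show ?thesis using assms by simp
qed

lemma cayley_dist_commute: "cayley_dist G S x y = cayley_dist G S y x"
proof -
  have "{L. cayley_path G S x y L} = {L. cayley_path G S y x L}" using cayley_path_sym by auto
  then show ?thesis by (simp add: cayley_dist_def)
qed

text \<open>A shorter connection between the two parameters, extended by the initial and final
  pieces of the path, would join its ends by less than their word distance.\<close>

lemma word_path_dist:
  assumes x: "x \<in> carrier G" and ws: "ws \<in> lists S" and geo: "wd x (x \<otimes> val ws) = length ws"
    and st: "0 \<le> s" "s \<le> t" "t \<le> real (length ws)"
  shows "cayley_dist G S (word_path x ws s) (word_path x ws t) = t - s"
  unfolding cayley_dist_def
proof (rule cInf_eq_minimum)
  show "t - s \<in> {L. cayley_path G S (word_path x ws s) (word_path x ws t) L}"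
    using word_path_le[OF x ws st] by simp
next
  fix L assume "L \<in> {L. cayley_path G S (word_path x ws s) (word_path x ws t) L}"
  then have L: "cayley_path G S (word_path x ws s) (word_path x ws t) L" by simp
  let ?n = "real (length ws)"
  have "cayley_path G S (word_path x ws 0) (word_path x ws s) s"
    "cayley_path G S (word_path x ws t) (word_path x ws ?n) (?n - t)"
    using word_path_le[OF x ws, of 0 s] word_path_le[OF x ws, of t ?n] st by auto
  then have "cayley_path G S (word_path x ws 0) (word_path x ws ?n) (s + L + (?n - t))"
    using cayley_path_trans[OF _ cayley_path_trans[OF L]] by blast
  then have "cayley_path G S (Vertex x) (Vertex (x \<otimes> val ws)) (s + L + (?n - t))"
    using word_path_vertex[of x ws 0] word_path_vertex[of x ws "length ws"] x by simp
  from cayley_path_vertex_length_ge[OF this HOL.refl x] show "t - s \<le> L"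
    using x geo lists_carrier[OF ws] by simp
qed

lemma word_path_geodesic:
  assumes x: "x \<in> carrier G" and ws: "ws \<in> lists S" and geo: "wd x (x \<otimes> val ws) = length ws"
  shows "geodesic_segment (cayley_graph G S) (cayley_dist G S) (Vertex x) (Vertex (x \<otimes> val ws))
           (word_path x ws ` {0..real (length ws)})"
  unfolding geodesic_segment_def
proof (rule exI[of _ "real (length ws)"], rule exI[of _ "word_path x ws"], intro conjI ballI)
  show "word_path x ws ` {0..real (length ws)} \<subseteq> cayley_graph G S"
  proof
    fix q assume "q \<in> word_path x ws ` {0..real (length ws)}"
    then obtain s where "0 \<le> s" "s \<le> real (length ws)" "q = word_path x ws s" by auto
    then show "q \<in> cayley_graph G S"
      using cayley_path_in_graph(1)[OF word_path_le[OF x ws, of s "real (length ws)"]] by simp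
  qed
  show "word_path x ws 0 = Vertex x"
    "word_path x ws (real (length ws)) = Vertex (x \<otimes> val ws)"
    using word_path_vertex[of x ws 0] word_path_vertex[of x ws "length ws"] x by auto
  fix s t assume "s \<in> {0..real (length ws)}" "t \<in> {0..real (length ws)}"
  then show "cayley_dist G S (word_path x ws s) (word_path x ws t) = \<bar>s - t\<bar>"
    using word_path_dist[OF x ws geo, of s t] word_path_dist[OF x ws geo, of t s]
      cayley_dist_commute[of "word_path x ws s" "word_path x ws t"] by (cases "s \<le> t") auto
qed auto

text \<open>Vertices \<open>y\<close> with \<open>d x y + d y z = d x z\<close> are those lying on some geodesic from \<open>x\<close> to \<open>z\<close>;
  this avoids naming the geodesics.\<close>

definition between :: "'a \<Rightarrow> 'a \<Rightarrow> 'a \<Rightarrow> bool" where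
  "between x y z \<longleftrightarrow> wd x y + wd y z = wd x z"

lemma between_commute:
  "x \<in> carrier G \<Longrightarrow> y \<in> carrier G \<Longrightarrow> z \<in> carrier G \<Longrightarrow> between x y z \<longleftrightarrow> between z y x"
  using wd_commute[of x y] wd_commute[of y z] wd_commute[of x z] by (auto simp: between_def)

lemma wd_word_le:
  "x \<in> carrier G \<Longrightarrow> ws \<in> lists S \<Longrightarrow> wd x (x \<otimes> val ws) \<le> length ws"
  using wlen_le[of ws] lists_carrier[of ws] by (simp add: wd_mult_right)

lemma take_drop_vertex:
  assumes "x \<in> carrier G" "ws \<in> lists S"
  shows "x \<otimes> val (take i ws) \<otimes> val (drop i ws) = x \<otimes> val ws"
proof -
  have "val ws = val (take i ws) \<otimes> val (drop i ws)"
    using word_val_append[of "take i ws" "drop i ws"]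
      lists_carrier[OF take_lists[OF assms(2)]] lists_carrier[OF drop_lists[OF assms(2)]] by simp
  then show ?thesis
    using assms lists_carrier[OF take_lists[OF assms(2)]] lists_carrier[OF drop_lists[OF assms(2)]]
    by (simp add: m_assoc)
qed

text \<open>Each of the two pieces spans at most its number of letters, and these numbers add up to
  the distance of the ends, so the triangle inequality must be an equality.\<close>

lemma geodesic_vertex:
  assumes x: "x \<in> carrier G" and ws: "ws \<in> lists S" and geo: "wd x (x \<otimes> val ws) = length ws"
    and i: "i \<le> length ws"
  shows "between x (x \<otimes> val (take i ws)) (x \<otimes> val ws)"
proof -
  let ?y = "x \<otimes> val (take i ws)"
  have y: "?y \<in> carrier G" "x \<otimes> val ws \<in> carrier G"
    using x lists_carrier[OF take_lists[OF ws]] lists_carrier[OF ws] by auto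
  have "wd x ?y \<le> i" "wd ?y (x \<otimes> val ws) \<le> length ws - i"
    using wd_word_le[OF x take_lists[OF ws, of i]] wd_word_le[OF y(1) drop_lists[OF ws, of i]]
      take_drop_vertex[OF x ws, of i] by auto
  moreover have "length ws \<le> wd x ?y + wd ?y (x \<otimes> val ws)"
    using wd_triangle[OF x y] geo by simp
  ultimately show ?thesis using geo i by (auto simp: between_def)
qed

lemma geodesic_segment_exists:
  assumes x: "x \<in> carrier G" "y \<in> carrier G"
  obtains ws where "ws \<in> lists S" "x \<otimes> val ws = y" "length ws = wd x y"
    "geodesic_segment (cayley_graph G S) (cayley_dist G S) (Vertex x) (Vertex y)
           (word_path x ws ` {0..real (length ws)})"
proof -
  obtain ws where "ws \<in> lists S" "length ws = wd x y" "x \<otimes> val ws = y"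
    by (rule wd_word[OF assms])
  then show ?thesis using word_path_geodesic[of x ws] that x by auto
qed

text \<open>By betweenness, geodesic words from \<open>x\<close> to \<open>y\<close> and from
  \<open>y\<close> to \<open>z\<close> concatenate to a geodesic word. This puts a given vertex on a
  side of a triangle.\<close>

lemma geodesic_through:
  assumes "x \<in> carrier G" "y \<in> carrier G" "z \<in> carrier G" "between x y z"
  obtains A where
    "geodesic_segment (cayley_graph G S) (cayley_dist G S) (Vertex x) (Vertex z) A" "Vertex y \<in> A"
proof -
  obtain us where u: "us \<in> lists S" "length us = wd x y" "x \<otimes> val us = y"
    by (rule wd_word[OF assms(1,2)])
  obtain vs where v: "vs \<in> lists S" "length vs = wd y z" "y \<otimes> val vs = z"
    by (rule wd_word[OF assms(2,3)])
  have w: "us @ vs \<in> lists S" using u v by auto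
  have z: "x \<otimes> val (us @ vs) = z"
    using u v assms lists_carrier by (auto simp: word_val_append simp flip: m_assoc)
  have "wd x (x \<otimes> val (us @ vs)) = length (us @ vs)"
    using z u v assms by (simp add: between_def)
  from word_path_geodesic[OF assms(1) w this]
  have "geodesic_segment (cayley_graph G S) (cayley_dist G S) (Vertex x) (Vertex z)
     (word_path x (us @ vs) ` {0..real (length (us @ vs))})" using z by simp
  moreover have "Vertex y \<in> word_path x (us @ vs) ` {0..real (length (us @ vs))}"
    using word_path_vertex[of x "us @ vs" "length us"] u by (intro image_eqI[of _ _ "real (length us)"]) auto
  ultimately show ?thesis by (rule that)
qed

text \<open>The \<open>+ 2\<close> pays for rounding \<open>q\<close> back to the previous vertex of
  the path and for replacing the infimum in the distance by an actual path.\<close>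

lemma near_word_path:
  assumes x: "x \<in> carrier G" and ws: "ws \<in> lists S" and geo: "wd x (x \<otimes> val ws) = length ws"
    and v: "v \<in> carrier G" and q: "q \<in> word_path x ws ` {0..real (length ws)}"
    and d: "cayley_dist G S (Vertex v) q \<le> \<delta>"
  shows "\<exists>y\<in>carrier G. between x y (x \<otimes> val ws) \<and> wd v y \<le> nat \<lceil>\<delta> + 2\<rceil>"
proof -
  obtain s where s: "0 \<le> s" "s \<le> real (length ws)" "q = word_path x ws s" using q by auto
  define i where "i = nat \<lfloor>s\<rfloor>"
  have i: "real i \<le> s" "s \<le> real i + 1" "i \<le> length ws" using s by (simp_all add: i_def, linarith+)
  let ?y = "x \<otimes> val (take i ws)"
  have y: "?y \<in> carrier G" using x lists_carrier[OF take_lists[OF ws]] by auto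
  have p1: "cayley_path G S (Vertex ?y) q (s - i)"
    using word_path_le[OF x ws, of "real i" s] i s word_path_vertex[of x ws i] by simp
  then have "{L. cayley_path G S (Vertex v) q L} \<noteq> {}"
    using cayley_path_trans[OF _ cayley_path_vertices[OF v y]] by blast
  from cInf_lessD[OF this, of "\<delta> + 1"] d obtain L where
    L: "cayley_path G S (Vertex v) q L" "L < \<delta> + 1" unfolding cayley_dist_def by auto
  have "cayley_path G S (Vertex v) (Vertex ?y) (L + (s - i))"
    using cayley_path_trans[OF cayley_path_sym[OF p1] L(1)] .
  from cayley_path_vertex_length_ge[OF this HOL.refl v y] L(2) i
  have "real (wd v ?y) \<le> \<delta> + 2" by linarith
  then have "wd v ?y \<le> nat \<lceil>\<delta> + 2\<rceil>" by linarith
  then show ?thesis using geodesic_vertex[OF x ws geo i(3)] y by auto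
qed

text \<open>Thinness is applied to one convenient triangle: the side from \<open>a\<close> to
  \<open>b\<close> is taken through \<open>v\<close>, the other two sides are arbitrary
  geodesics.\<close>

lemma thin_triangles_vertices:
  assumes thin: "thin_triangles (cayley_graph G S) (cayley_dist G S) \<delta>"
    and a: "a \<in> carrier G" and b: "b \<in> carrier G" and c: "c \<in> carrier G"
    and v: "v \<in> carrier G" "between a v b"
  shows "\<exists>y\<in>carrier G. (between b y c \<or> between a y c) \<and> wd v y \<le> nat \<lceil>\<delta> + 2\<rceil>"
proof -
  obtain A where A: "geodesic_segment (cayley_graph G S) (cayley_dist G S) (Vertex a) (Vertex b) A"
    "Vertex v \<in> A" by (rule geodesic_through[OF a v(1) b v(2)])
  obtain us where u: "us \<in> lists S" "b \<otimes> val us = c" "length us = wd b c"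
    "geodesic_segment (cayley_graph G S) (cayley_dist G S) (Vertex b) (Vertex c)
           (word_path b us ` {0..real (length us)})" (is "geodesic_segment _ _ _ _ ?B")
    by (rule geodesic_segment_exists[OF b c])
  obtain vs where w: "vs \<in> lists S" "c \<otimes> val vs = a" "length vs = wd c a"
    "geodesic_segment (cayley_graph G S) (cayley_dist G S) (Vertex c) (Vertex a)
           (word_path c vs ` {0..real (length vs)})" (is "geodesic_segment _ _ _ _ ?C")
    by (rule geodesic_segment_exists[OF c a])
  have "Vertex v \<in> neighborhood (cayley_graph G S) (cayley_dist G S) \<delta> (?B \<union> ?C)"
    using thin A u(4) w(4) unfolding thin_triangles_def by blast
  then obtain q where "q \<in> ?B \<or> q \<in> ?C" "cayley_dist G S (Vertex v) q \<le> \<delta>"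
    unfolding neighborhood_def by blast
  then show ?thesis
    using near_word_path[OF b u(1) _ v(1), of q \<delta>] near_word_path[OF c w(1) _ v(1), of q \<delta>]
      u(2,3) w(2,3) between_commute[of c _ a] a c by auto
qed

subsection \<open>Local geodesics\<close>

text \<open>Twice the Gromov product of \<open>x\<close> and \<open>y\<close> at \<open>w\<close>.\<close>

definition gp :: "'a \<Rightarrow> 'a \<Rightarrow> 'a \<Rightarrow> int" where
  "gp w x y = int (wd w x) + int (wd w y) - int (wd x y)"

section \<open>The four-point inequality for Gromov products\<close>

definition four_point :: "int \<Rightarrow> bool" where
  "four_point \<Delta> \<longleftrightarrow> (\<forall>w\<in>carrier G. \<forall>x\<in>carrier G. \<forall>y\<in>carrier G. \<forall>z\<in>carrier G.
     min (gp w x y) (gp w y z) - \<Delta> \<le> gp w x z)"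

lemma gp_commute: "x \<in> carrier G \<Longrightarrow> y \<in> carrier G \<Longrightarrow> gp w x y = gp w y x"
  using wd_commute[of x y] by (simp add: gp_def)

lemma gp_add: "x \<in> carrier G \<Longrightarrow> y \<in> carrier G \<Longrightarrow> z \<in> carrier G \<Longrightarrow>
    gp x y z + gp y x z = 2 * int (wd x y)"
  using wd_commute[of x y] by (simp add: gp_def)

lemma gp_le_dist_between:
  assumes "w \<in> carrier G" "x \<in> carrier G" "y \<in> carrier G" "p \<in> carrier G" "between x p y"
  shows "gp w x y \<le> 2 * int (wd w p)"
  using wd_triangle[of w p x] wd_triangle[of w p y] wd_commute[of p x] assms
  by (simp add: gp_def between_def)

text \<open>Walking from \<open>x\<close> to \<open>y\<close>, the last vertex within
  \<open>D\<close> of the side joining \<open>x\<close> and \<open>w\<close> is within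
  \<open>D + 1\<close> of the side joining \<open>y\<close> and \<open>w\<close>, because its
  successor, if there is one, is within \<open>D\<close> of that side. Passing through the near
  points on the two sides costs \<open>2 * D\<close> and \<open>2 * (D + 1)\<close>.\<close>

lemma exists_between_dist_le_gp:
  assumes thin: "\<And>a b c v. a \<in> carrier G \<Longrightarrow> b \<in> carrier G \<Longrightarrow> c \<in> carrier G \<Longrightarrow> v \<in> carrier G \<Longrightarrow>
      between a v b \<Longrightarrow> \<exists>y\<in>carrier G. (between b y c \<or> between a y c) \<and> wd v y \<le> D"
    and w: "w \<in> carrier G" and x: "x \<in> carrier G" and y: "y \<in> carrier G"
  shows "\<exists>p\<in>carrier G. between x p y \<and> 2 * int (wd w p) \<le> gp w x y + 4 * int D + 2"
proof -
  obtain ws where ws: "ws \<in> lists S" "length ws = wd x y" "x \<otimes> val ws = y"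
    by (rule wd_word[OF x y])
  define v where "v i = x \<otimes> val (take i ws)" for i
  have v: "v i \<in> carrier G" for i
    using x lists_carrier[OF take_lists[OF ws(1)]] by (simp add: v_def)
  have vb: "between x (v i) y" if "i \<le> length ws" for i
    using geodesic_vertex[OF x ws(1) _ that] ws by (simp add: v_def)
  define near where "near a k i \<longleftrightarrow> (\<exists>q\<in>carrier G. between a q w \<and> wd (v i) q \<le> k)" for a k i
  have near_or: "near x D i \<or> near y D i" if "i \<le> length ws" for i
    using thin[OF x y w v vb[OF that]] by (auto simp: near_def)
  have near_0: "near x D 0" and near_n: "near y D (length ws)"
    using x y w ws by (auto simp: near_def v_def between_def intro: bexI[of _ x] bexI[of _ y])
  have "\<exists>i\<le>length ws. near x D i \<and> near y (D + 1) i"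
  proof -
    define i where "i = Max {i. i \<le> length ws \<and> near x D i}"
    have fin: "finite {i. i \<le> length ws \<and> near x D i}" by simp
    have "{i. i \<le> length ws \<and> near x D i} \<noteq> {}" using near_0 by auto
    from Max_in[OF fin this] have i: "i \<le> length ws" "near x D i" by (auto simp: i_def)
    show ?thesis
    proof (cases "i = length ws")
      case True
      obtain q where "q \<in> carrier G" "between y q w" "wd (v i) q \<le> D"
        using near_n True unfolding near_def by blast
      then have "near y (D + 1) i" unfolding near_def by (intro bexI[of _ q]) auto
      then show ?thesis using i by blast
    next
      case False
      have "\<not> near x D (Suc i)"
      proof
        assume "near x D (Suc i)"
        then have "Suc i \<le> i" using Max_ge[OF fin, of "Suc i"] False i(1) unfolding i_def by simp
        then show False by simp
      qed
      then have "near y D (Suc i)" using near_or[of "Suc i"] False i by auto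
      then obtain q where q: "q \<in> carrier G" "between y q w" "wd (v (Suc i)) q \<le> D"
        unfolding near_def by blast
      have "v (Suc i) = v i \<otimes> ws ! i"
        using vertex_Suc[OF x ws(1), of i] False i by (simp add: v_def)
      moreover have "ws ! i \<in> S" using False i ws by auto
      ultimately have "wd (v i) (v (Suc i)) \<le> 1" using wd_generator[OF v, of "ws ! i" i] by simp
      then have "wd (v i) q \<le> D + 1" using q wd_triangle[OF v v q(1), of i "Suc i"] by simp
      then show ?thesis using i q unfolding near_def by blast
    qed
  qed
  then obtain i q r where i: "i \<le> length ws"
    and q: "q \<in> carrier G" "between x q w" "wd (v i) q \<le> D"
    and r: "r \<in> carrier G" "between y r w" "wd (v i) r \<le> D + 1"
    unfolding near_def by blast
  have "wd w (v i) \<le> wd w q + wd q (v i)" "wd x (v i) \<le> wd x q + wd q (v i)"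
    "wd w (v i) \<le> wd w r + wd r (v i)" "wd y (v i) \<le> wd y r + wd r (v i)"
    using wd_triangle[OF w q(1) v] wd_triangle[OF x q(1) v] wd_triangle[OF w r(1) v]
      wd_triangle[OF y r(1) v] by auto
  moreover have "wd q (v i) = wd (v i) q" "wd r (v i) = wd (v i) r" "wd q w = wd w q" "wd r w = wd w r"
    "wd x w = wd w x" "wd y w = wd w y" "wd (v i) y = wd y (v i)"
    by (rule wd_commute; use w x y q r v in simp)+
  ultimately have "2 * int (wd w (v i)) \<le> gp w x y + 4 * int D + 2"
    using q(2,3) r(2,3) vb[OF i] unfolding gp_def between_def by linarith
  then show ?thesis using vb[OF i] v by blast
qed

text \<open>A point \<open>p\<close> between \<open>x\<close> and \<open>z\<close> realises
  \<open>gp w x z\<close> up to \<open>4 * D + 2\<close>. Thinness moves \<open>p\<close> by at most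
  \<open>D\<close> to a point between \<open>x\<close> and \<open>y\<close> or between
  \<open>z\<close> and \<open>y\<close>, and twice the distance of that point to \<open>w\<close>
  bounds the corresponding product; this adds \<open>2 * D\<close>.\<close>

lemma four_pointI:
  assumes thin: "\<And>a b c v. a \<in> carrier G \<Longrightarrow> b \<in> carrier G \<Longrightarrow> c \<in> carrier G \<Longrightarrow> v \<in> carrier G \<Longrightarrow>
      between a v b \<Longrightarrow> \<exists>y\<in>carrier G. (between b y c \<or> between a y c) \<and> wd v y \<le> D"
  shows "four_point (6 * int D + 2)"
  unfolding four_point_def
proof (intro ballI)
  fix w x y z assume c: "w \<in> carrier G" "x \<in> carrier G" "y \<in> carrier G" "z \<in> carrier G"
  obtain p where p: "p \<in> carrier G" "between x p z" "2 * int (wd w p) \<le> gp w x z + 4 * int D + 2"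
    using exists_between_dist_le_gp[OF thin c(1,2,4)] by blast
  obtain q where q: "q \<in> carrier G" "between z q y \<or> between x q y" "wd p q \<le> D"
    using thin[OF c(2,4,3) p(1,2)] by blast
  have "gp w x y \<le> 2 * int (wd w q) \<or> gp w y z \<le> 2 * int (wd w q)"
    using q c gp_le_dist_between[of w x y q] gp_le_dist_between[of w z y q] gp_commute[of y z w] by auto
  moreover have "wd w q \<le> wd w p + D" using wd_triangle[OF c(1) p(1) q(1)] q(3) by simp
  ultimately show "min (gp w x y) (gp w y z) - (6 * int D + 2) \<le> gp w x z" using p(3) by linarith
qed

lemma four_pointD:
  "four_point \<Delta> \<Longrightarrow> w \<in> carrier G \<Longrightarrow> x \<in> carrier G \<Longrightarrow> y \<in> carrier G \<Longrightarrow> z \<in> carrier G \<Longrightarrow>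
     gp w x y \<le> gp w x z + \<Delta> \<or> gp w y z \<le> gp w x z + \<Delta>"
proof -
  assume "four_point \<Delta>" "w \<in> carrier G" "x \<in> carrier G" "y \<in> carrier G" "z \<in> carrier G"
  then have "min (gp w x y) (gp w y z) - \<Delta> \<le> gp w x z" by (simp add: four_point_def)
  then show ?thesis by linarith
qed

section \<open>Local geodesics under the four-point inequality\<close>

definition local_geodesic :: "nat \<Rightarrow> nat \<Rightarrow> (nat \<Rightarrow> 'a) \<Rightarrow> bool" where
  "local_geodesic R L x \<longleftrightarrow> (\<forall>i\<le>L. x i \<in> carrier G) \<and>
     (\<forall>i j. i \<le> j \<longrightarrow> j \<le> L \<longrightarrow> j \<le> i + R \<longrightarrow> wd (x i) (x j) = j - i)"

lemma local_geodesicD: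
  "local_geodesic R L x \<Longrightarrow> i \<le> j \<Longrightarrow> j \<le> L \<Longrightarrow> j \<le> i + R \<Longrightarrow> wd (x i) (x j) = j - i"
  by (simp add: local_geodesic_def)

lemma local_geodesic_rev:
  assumes "local_geodesic R L x" shows "local_geodesic R L (\<lambda>i. x (L - i))"
  unfolding local_geodesic_def
proof (intro conjI allI impI)
  fix i j assume "i \<le> j" "j \<le> L" "j \<le> i + R"
  then show "wd (x (L - i)) (x (L - j)) = j - i"
    using local_geodesicD[OF assms, of "L - j" "L - i"] assms
      wd_commute[of "x (L - i)" "x (L - j)"] by (auto simp: local_geodesic_def)
qed (use assms in \<open>auto simp: local_geodesic_def\<close>)

text \<open>Induction in steps of \<open>r\<close>. The product at \<open>x (i - r)\<close> is at
  most \<open>\<Delta>\<close>, so the product of \<open>x (i - r)\<close> and \<open>x 0\<close> at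
  \<open>x i\<close> is at least \<open>2 * r - \<Delta>\<close>, which exceeds
  \<open>\<Delta>\<close>. As the window around \<open>x i\<close> is geodesic, the product of
  \<open>x (i - r)\<close> and \<open>x (i + t)\<close> there is 0, and the four-point inequality
  leaves only the claim.\<close>

lemma local_geodesic_start:
  assumes four: "four_point \<Delta>" and lg: "local_geodesic (2 * r) L x"
    and r: "\<Delta> < int r" "0 \<le> \<Delta>" and "t \<le> r" "i + t \<le> L"
  shows "gp (x i) (x 0) (x (i + t)) \<le> \<Delta>"
  using assms(5,6)
proof (induction i arbitrary: t rule: less_induct)
  case (less i)
  have c: "x j \<in> carrier G" if "j \<le> L" for j using lg that by (auto simp: local_geodesic_def)
  have d: "wd (x j) (x k) = k - j" "wd (x k) (x j) = k - j" if "j \<le> k" "k \<le> L" "k \<le> j + 2 * r" for j k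
  proof -
    show "wd (x j) (x k) = k - j" by (rule local_geodesicD[OF lg that])
    then show "wd (x k) (x j) = k - j" using wd_commute[of "x k" "x j"] c that by simp
  qed
  show ?case
  proof (cases "i \<le> r")
    case True
    then show ?thesis using d[of 0 i] d[of i "i + t"] d[of 0 "i + t"] less.prems r by (simp add: gp_def)
  next
    case False
    let ?y = "x (i - r)"
    have "gp ?y (x 0) (x (i - r + r)) \<le> \<Delta>"
      by (rule less.IH) (use False less.prems r in auto)
    then have "gp ?y (x i) (x 0) \<le> \<Delta>" using False less.prems gp_commute[OF c c, of 0 i ?y] by simp
    moreover have "gp (x i) ?y (x 0) + gp ?y (x i) (x 0) = 2 * int r"
      using gp_add[OF c c c, of i "i - r" 0] d[of "i - r" i] False less.prems by simp
    moreover have "gp (x i) ?y (x (i + t)) = 0"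
      using d[of "i - r" i] d[of i "i + t"] d[of "i - r" "i + t"] less.prems False by (simp add: gp_def)
    moreover have "gp (x i) ?y (x 0) \<le> gp (x i) ?y (x (i + t)) + \<Delta> \<or>
        gp (x i) (x 0) (x (i + t)) \<le> gp (x i) ?y (x (i + t)) + \<Delta>"
      by (rule four_pointD[OF four]) (use c less.prems in auto)
    ultimately show ?thesis using r by linarith
  qed
qed

text \<open>The path is cut at \<open>x (i + r)\<close> and the previous bound is used from both
  ends. The unwanted alternative of the four-point inequality would give
  \<open>2 * r - \<Delta> \<le> 2 * \<Delta>\<close>, against
  \<open>3 * \<Delta> < 2 * r\<close>.\<close>

lemma local_geodesic_gp:
  assumes four: "four_point \<Delta>" and lg: "local_geodesic (2 * r) L x"
    and r: "3 * \<Delta> < 2 * int r" "\<Delta> < int r" "0 \<le> \<Delta>" and i: "i \<le> L"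
  shows "gp (x i) (x 0) (x L) \<le> 2 * \<Delta>"
proof (cases "L - i \<le> r")
  case True
  then show ?thesis using local_geodesic_start[OF four lg r(2,3) True, of i] i r by simp
next
  case False
  have c: "x j \<in> carrier G" if "j \<le> L" for j using lg that by (auto simp: local_geodesic_def)
  let ?v = "x (i + r)"
  \<comment> \<open>This is the bound for the reversed path, on which \<open>x (i + r)\<close> has
    the index \<open>L - (i + r)\<close>.\<close>
  have "gp (x (L - (L - (i + r)))) (x (L - 0)) (x (L - (L - (i + r) + r))) \<le> \<Delta>"
    by (rule local_geodesic_start[OF four local_geodesic_rev[OF lg] r(2,3)]) (use False in auto)
  then have "gp ?v (x L) (x i) \<le> \<Delta>" using False by simp
  then have "gp ?v (x i) (x L) \<le> \<Delta>" using gp_commute[OF c c, of i L ?v] i by simp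
  moreover have "gp (x i) ?v (x L) + gp ?v (x i) (x L) = 2 * int r"
    using gp_add[OF c c c, of i "i + r" L] lg False i by (simp add: local_geodesic_def)
  moreover have "gp (x i) (x 0) ?v \<le> \<Delta>"
    by (rule local_geodesic_start[OF four lg r(2,3)]) (use False in auto)
  moreover have "gp (x i) (x 0) (x L) \<le> gp (x i) (x 0) ?v + \<Delta> \<or>
        gp (x i) (x L) ?v \<le> gp (x i) (x 0) ?v + \<Delta>"
    by (rule four_pointD[OF four]) (use c i False in auto)
  moreover have "gp (x i) (x L) ?v = gp (x i) ?v (x L)" by (rule gp_commute) (use c False in auto)
  ultimately show ?thesis using r by linarith
qed

text \<open>On a closed path longer than \<open>2 * r\<close>, the product of the two equal ends at
  \<open>x r\<close> is \<open>2 * r\<close>, above the bound \<open>2 * \<Delta>\<close>. A shorter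
  path is geodesic, so its ends coincide only if it is trivial.\<close>

lemma no_closed_local_geodesic:
  assumes four: "four_point \<Delta>" and lg: "local_geodesic (2 * r) L x"
    and r: "3 * \<Delta> < 2 * int r" "\<Delta> < int r" "0 \<le> \<Delta>" and closed: "x L = x 0"
  shows "L = 0"
proof (rule ccontr)
  assume L: "L \<noteq> 0"
  have c: "x j \<in> carrier G" if "j \<le> L" for j using lg that by (auto simp: local_geodesic_def)
  show False
  proof (cases "L \<le> 2 * r")
    case True
    have "wd (x 0) (x L) = L - 0" by (rule local_geodesicD[OF lg]) (use True in auto)
    then show False using L closed c[of 0] by simp
  next
    case False
    have "wd (x 0) (x r) = r - 0" by (rule local_geodesicD[OF lg]) (use False in auto)
    moreover have "wd (x r) (x 0) = wd (x 0) (x r)" by (rule wd_commute) (use c False in auto)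
    ultimately have "gp (x r) (x 0) (x L) = 2 * int r"
      using closed c[of 0] by (simp add: gp_def)
    then show False using local_geodesic_gp[OF four lg r, of r] False r by simp
  qed
qed

text \<open>The four-point inequality applied to the endpoints and to a vertex of each path.\<close>

lemma local_geodesics_fellow_travel:
  assumes four: "four_point \<Delta>" and lg: "local_geodesic (2 * r) L x" "local_geodesic (2 * r) L' x'"
    and r: "3 * \<Delta> < 2 * int r" "\<Delta> < int r" "0 \<le> \<Delta>" and i: "i \<le> L"
    and start: "x' 0 = x 0" and ends: "wd (x L) (x' L') \<le> m"
  shows "\<exists>k\<le>L'. int (wd (x i) (x' k)) \<le> 3 * int m + 5 * \<Delta>"
proof -
  have c: "x j \<in> carrier G" if "j \<le> L" for j using lg that by (auto simp: local_geodesic_def)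
  have c': "x' j \<in> carrier G" if "j \<le> L'" for j using lg that by (auto simp: local_geodesic_def)
  have r1: "1 \<le> r" using r by linarith
  let ?o = "x 0" and ?h = "x L" and ?h' = "x' L'"
  let ?\<rho> = "wd ?o (x i)"
  have o: "?o \<in> carrier G" using c by auto
  have gpx: "gp (x i) ?o ?h \<le> 2 * \<Delta>" by (rule local_geodesic_gp[OF four lg(1) r i])
  have c0: "x L \<in> carrier G" "x' L' \<in> carrier G" "x i \<in> carrier G" using c c' i by auto
  have comm: "wd ?h' ?h = wd ?h ?h'" by (rule wd_commute[OF c0(2,1)])
  have hh: "wd ?o ?h \<le> wd ?o ?h' + m"
    using wd_triangle[OF o c0(2,1)] ends comm by linarith
  have hh': "wd ?o ?h' \<le> wd ?o ?h + m"
    using wd_triangle[OF o c0(1,2)] ends by linarith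
  \<comment> \<open>The vertex to compare with \<open>x i\<close> has nearly the same distance from
    the common start: it is the one before \<open>x'\<close> first gets farther away, or the end of
    \<open>x'\<close> if that end is not farther away.\<close>
  have "\<exists>k\<le>L'. wd ?o (x' k) \<le> ?\<rho> \<and> int ?\<rho> - 2 * \<Delta> - m \<le> int (wd ?o (x' k))"
  proof (cases "wd ?o ?h' \<le> ?\<rho>")
    case True
    have "wd (x i) ?o = ?\<rho>" by (rule wd_commute[OF c0(3) o])
    then have "int ?\<rho> \<le> wd ?o ?h + 2 * \<Delta>" using gpx unfolding gp_def by linarith
    then have "int ?\<rho> - 2 * \<Delta> - m \<le> int (wd ?o ?h')" using hh by linarith
    then show ?thesis using True by blast
  next
    case False
    define k where "k = (LEAST k. ?\<rho> < wd ?o (x' k))"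
    have "?\<rho> < wd ?o ?h'" using False by simp
    then have ex: "?\<rho> < wd ?o (x' k)" and k: "k \<le> L'"
      unfolding k_def by (rule LeastI, rule Least_le)
    have "k \<noteq> 0"
    proof
      assume "k = 0"
      then show False using ex start wd_self[OF o] by simp
    qed
    then obtain j where j: "k = Suc j" using not0_implies_Suc by blast
    have le: "\<not> ?\<rho> < wd ?o (x' j)" by (rule not_less_Least) (use j in \<open>simp flip: k_def\<close>)
    have "wd (x' j) (x' (Suc j)) = Suc j - j"
      by (rule local_geodesicD[OF lg(2)]) (use k j r1 in auto)
    moreover have "wd ?o (x' (Suc j)) \<le> wd ?o (x' j) + wd (x' j) (x' (Suc j))"
      by (rule wd_triangle[OF o c' c']) (use k j in auto)
    ultimately have "wd ?o (x' k) \<le> wd ?o (x' j) + 1" using j by simp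
    then have "wd ?o (x' j) \<le> ?\<rho>" "int ?\<rho> - 2 * \<Delta> - m \<le> int (wd ?o (x' j))"
      using le ex r(3) by linarith+
    moreover have "j \<le> L'" using j k by simp
    ultimately show ?thesis by blast
  qed
  then obtain k where k: "k \<le> L'" "wd ?o (x' k) \<le> ?\<rho>" "int ?\<rho> - 2 * \<Delta> - m \<le> int (wd ?o (x' k))"
    by blast
  have gpx': "gp (x' k) ?o ?h' \<le> 2 * \<Delta>"
    using local_geodesic_gp[OF four lg(2) r k(1)] start by simp
  have "wd (x' k) ?h \<le> wd (x' k) ?h' + m"
    using wd_triangle[OF c'[OF k(1)] c0(2,1)] ends comm by linarith
  \<comment> \<open>By \<open>gpx\<close> and \<open>gpx'\<close> both left-hand products are nearly
    twice the distance from the start, so either alternative bounds the distance of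
    \<open>x i\<close> and \<open>x' k\<close>.\<close>
  moreover have "gp ?o (x i) ?h \<le> gp ?o (x i) (x' k) + \<Delta> \<or> gp ?o ?h (x' k) \<le> gp ?o (x i) (x' k) + \<Delta>"
    by (rule four_pointD[OF four]) (use c c' i k in auto)
  moreover have "wd (x i) ?o = ?\<rho>" "wd (x' k) ?o = wd ?o (x' k)" "wd ?h (x' k) = wd (x' k) ?h"
    by (rule wd_commute; use c c' o i k in simp)+
  ultimately have "int (wd (x i) (x' k)) \<le> 3 * int m + 5 * \<Delta>"
    using k gpx gpx' hh' r(3) unfolding gp_def by linarith
  then show ?thesis using k by blast
qed

end

section \<open>Extensions by the integers\<close>

text \<open>Surjectivity of \<open>p\<close> is contained in the last assumption, since
  \<open>X\<close> generates \<open>H\<close>. The set \<open>L\<close> may contain several lifts of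
  one generator.\<close>

locale z_extension = group G + H: generated_group H X
  for G :: "('a, 'c) monoid_scheme" (structure) and H :: "('b, 'd) monoid_scheme" and X +
  fixes f :: "int \<Rightarrow> 'a" and p :: "'a \<Rightarrow> 'b" and L
  assumes f_closed [simp]: "f a \<in> carrier G"
    and f_add: "f (a + b) = f a \<otimes> f b"
    and f_inj: "inj f"
    and p_hom: "p \<in> hom G H"
    and kernel_p: "g \<in> carrier G \<Longrightarrow> p g = \<one>\<^bsub>H\<^esub> \<longleftrightarrow> g \<in> range f"
    and L_finite: "finite L" and L_carrier: "L \<subseteq> carrier G" and L_inv: "s \<in> L \<Longrightarrow> inv s \<in> L"
    and p_L: "p ` L = X"
begin

sublocale p: group_hom G H p
  using p_hom by unfold_locales

abbreviation "val \<equiv> word_val G"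

lemma f_0: "f 0 = \<one>"
  using f_add[of 0 0] f_closed[of 0] by (metis add_0 l_cancel_one)

lemma f_minus: "f (- a) = inv (f a)"
  using f_add[of "- a" a] f_0 by (metis add.left_inverse f_closed inv_equality)

lemma additive_int:
  assumes "\<And>a b::int. h (a + b) = h a + h b"
  shows "h c = c * (h 1 :: int)"
proof (induction c rule: int_induct[of _ 0])
  case base
  show ?case using assms[of 0 0] by simp
next
  case (step1 i)
  then show ?case using assms[of i 1] by (simp add: algebra_simps)
next
  case (step2 i)
  then show ?case using assms[of "i - 1" 1] by (simp add: algebra_simps)
qed

text \<open>Conjugation is an automorphism of the infinite cyclic kernel, hence \<open>c \<mapsto> \<plusminus>c\<close>.\<close>

lemma f_conj:
  assumes g: "g \<in> carrier G"
  shows "\<exists>c'. \<bar>c'\<bar> = \<bar>c\<bar> \<and> g \<otimes> f c = f c' \<otimes> g"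
proof -
  have ex: "\<exists>c'. f c' = g \<otimes> f c \<otimes> inv g" if "g \<in> carrier G" for g c
  proof -
    have "p (f c) = \<one>\<^bsub>H\<^esub>" using kernel_p[of "f c"] by simp
    then have "p (g \<otimes> f c \<otimes> inv g) = \<one>\<^bsub>H\<^esub>" using that by simp
    moreover have "g \<otimes> f c \<otimes> inv g \<in> carrier G" using that by simp
    ultimately have "g \<otimes> f c \<otimes> inv g \<in> range f" using kernel_p by blast
    then obtain c' where "g \<otimes> f c \<otimes> inv g = f c'" by (rule rangeE)
    then show ?thesis by (intro exI[of _ c']) (rule sym)
  qed
  define \<phi> where "\<phi> g c = (SOME c'. f c' = g \<otimes> f c \<otimes> inv g)" for g c
  have \<phi>: "f (\<phi> g c) = g \<otimes> f c \<otimes> inv g" if "g \<in> carrier G" for g c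
    unfolding \<phi>_def by (rule someI_ex[OF ex[OF that]])
  have add: "\<phi> g (a + b) = \<phi> g a + \<phi> g b" if "g \<in> carrier G" for g a b
  proof -
    have "f (\<phi> g (a + b)) = f (\<phi> g a + \<phi> g b)"
      using that by (simp add: f_add \<phi> m_assoc)
    then show ?thesis using f_inj by (simp add: inj_eq)
  qed
  have lin: "\<phi> g c = c * \<phi> g 1" if "g \<in> carrier G" for g c
    by (rule additive_int) (rule add[OF that])
  \<comment> \<open>Conjugations by \<open>g\<close> and by \<open>inv g\<close> are inverse to each
    other, so their integer multipliers have product 1 and are units.\<close>
  have "f (\<phi> g (\<phi> (inv g) 1)) = f 1" using g by (simp add: \<phi> m_assoc)
  then have "\<phi> g (\<phi> (inv g) 1) = 1" using f_inj by (simp add: inj_eq)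
  then have "\<phi> (inv g) 1 * \<phi> g 1 = 1" using lin[OF g, of "\<phi> (inv g) 1"] by simp
  then have "\<bar>\<phi> g 1 * \<phi> (inv g) 1\<bar> = 1" by (simp add: mult.commute)
  then have "\<bar>\<phi> g 1\<bar> = 1" by (rule abs_zmult_eq_1)
  then have "\<bar>\<phi> g c\<bar> = \<bar>c\<bar>" using lin[OF g, of c] by (simp add: abs_mult)
  moreover have "g \<otimes> f c = f (\<phi> g c) \<otimes> g" using g by (simp add: \<phi> m_assoc)
  ultimately show ?thesis by blast
qed

lemma same_image:
  assumes "g \<in> carrier G" "h \<in> carrier G" "p g = p h"
  shows "\<exists>c. g = f c \<otimes> h"
proof -
  have "p (g \<otimes> inv h) = \<one>\<^bsub>H\<^esub>" using assms by simp
  moreover have "g \<otimes> inv h \<in> carrier G" using assms by simp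
  ultimately have "g \<otimes> inv h \<in> range f" using kernel_p by blast
  then obtain c where c: "g \<otimes> inv h = f c" by (rule rangeE)
  have "f c \<otimes> h = g" unfolding c[symmetric] using assms by (simp add: m_assoc)
  then show ?thesis by blast
qed

section \<open>Words in the lifted generators\<close>

lemma L_lists: "ws \<in> lists L \<Longrightarrow> set ws \<subseteq> carrier G"
  using L_carrier by auto

lemma val_closed [simp]: "ws \<in> lists L \<Longrightarrow> val ws \<in> carrier G"
  using L_lists by simp

lemma val_append: "us \<in> lists L \<Longrightarrow> vs \<in> lists L \<Longrightarrow> val (us @ vs) = val us \<otimes> val vs"
  by (simp add: word_val_append L_lists)

definition inverse_word :: "'a list \<Rightarrow> 'a list" where
  "inverse_word ws = rev (map (m_inv G) ws)"

lemma inverse_word: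
  assumes "ws \<in> lists L"
  shows "inverse_word ws \<in> lists L" "length (inverse_word ws) = length ws"
    "val (inverse_word ws) = inv (val ws)"
  using assms L_inv L_lists by (auto simp: inverse_word_def word_val_inverse)

lemma p_val: "ws \<in> lists L \<Longrightarrow> p (val ws) = word_val H (map p ws)"
proof (induction ws)
  case (Cons a ws)
  then have "a \<in> carrier G" "val ws \<in> carrier G" using L_carrier by auto
  with Cons show ?case by simp
qed simp

lemma map_p_lists: "ws \<in> lists L \<Longrightarrow> map p ws \<in> lists X"
  using p_L by auto

lemma lift_word:
  assumes "h \<in> carrier H"
  obtains ws where "ws \<in> lists L" "length ws = H.wlen h" "p (val ws) = h"
proof -
  obtain vs where vs: "vs \<in> lists X" "length vs = H.wlen h" "word_val H vs = h"
    by (rule H.wlen_word[OF assms])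
  have "vs \<in> map p ` lists L" using vs(1) unfolding p_L[symmetric] lists_image .
  then obtain ws where "ws \<in> lists L" "vs = map p ws" by blast
  then show ?thesis using vs p_val that by simp
qed

lemma wlen_p_val: "ws \<in> lists L \<Longrightarrow> H.wlen (p (val ws)) \<le> length ws"
  using H.wlen_le[OF map_p_lists[of ws]] by (simp add: p_val)

text \<open>Moving the kernel element to the front past \<open>A\<close> can only change its sign,
  so a replacement costs the same anywhere in a word.\<close>

lemma replace_subword:
  assumes "A \<in> lists L" "U \<in> lists L" "V \<in> lists L" "B \<in> lists L" "val U = f c \<otimes> val V"
  shows "\<exists>c'. \<bar>c'\<bar> = \<bar>c\<bar> \<and> val (A @ U @ B) = f c' \<otimes> val (A @ V @ B)"
proof -
  obtain c' where c': "\<bar>c'\<bar> = \<bar>c\<bar>" "val A \<otimes> f c = f c' \<otimes> val A" using f_conj[of "val A" c] assms by auto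
  have "val (A @ U @ B) = (val A \<otimes> f c) \<otimes> val V \<otimes> val B" using assms by (simp add: val_append m_assoc)
  also have "\<dots> = f c' \<otimes> val (A @ V @ B)" unfolding c' using assms by (simp add: val_append m_assoc)
  finally show ?thesis using c' by blast
qed

section \<open>Traces of words in \<open>H\<close> and shortcuts along them\<close>

definition trace :: "'a list \<Rightarrow> nat \<Rightarrow> 'b" where
  "trace Q i = p (val (take i Q))"

lemma take_drop_L: "Q \<in> lists L \<Longrightarrow> take i Q \<in> lists L" "Q \<in> lists L \<Longrightarrow> drop i Q \<in> lists L"
  by (rule H.take_lists H.drop_lists, assumption)+

lemma trace_closed [simp]: "Q \<in> lists L \<Longrightarrow> trace Q i \<in> carrier H"
  using take_drop_L by (simp add: trace_def)

lemma trace_0 [simp]: "trace Q 0 = \<one>\<^bsub>H\<^esub>"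
  by (simp add: trace_def)

lemma trace_length [simp]: "trace Q (length Q) = p (val Q)"
  by (simp add: trace_def)

lemma split_word:
  assumes Q: "Q \<in> lists L" and ij: "i \<le> j" "j \<le> length Q"
  obtains U where "U \<in> lists L" "length U = j - i" "Q = take i Q @ U @ drop j Q"
    "trace Q j = trace Q i \<otimes>\<^bsub>H\<^esub> p (val U)"
proof -
  let ?U = "take (j - i) (drop i Q)"
  have U: "?U \<in> lists L" using Q take_drop_L by blast
  have e: "take j Q = take i Q @ ?U"
    using ij by (metis le_add_diff_inverse take_add)
  then have "Q = take i Q @ ?U @ drop j Q" by (metis append.assoc append_take_drop_id)
  moreover have "trace Q j = trace Q i \<otimes>\<^bsub>H\<^esub> p (val ?U)"
    unfolding trace_def e using U take_drop_L[OF Q] by (simp add: val_append)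
  moreover have "length ?U = j - i" using ij by simp
  ultimately show ?thesis using U by (intro that)
qed

lemma trace_dist_le:
  assumes Q: "Q \<in> lists L" and ij: "i \<le> j" "j \<le> length Q"
  shows "H.wd (trace Q i) (trace Q j) \<le> j - i"
proof -
  obtain U where U: "U \<in> lists L" "length U = j - i" "trace Q j = trace Q i \<otimes>\<^bsub>H\<^esub> p (val U)"
    by (rule split_word[OF assms])
  then show ?thesis using wlen_p_val[of U] Q by (simp add: H.wd_mult_right)
qed

text \<open>The word \<open>V\<close> lifts a geodesic of \<open>H\<close> between two points of the
  trace. Replacing \<open>U\<close> by \<open>V\<close> drives Dehn's algorithm and also tests
  expressions of least weight.\<close>

lemma shortcut:
  assumes Q: "Q \<in> lists L" and ij: "i \<le> j" "j \<le> length Q"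
  obtains U V where "U \<in> lists L" "V \<in> lists L" "length U = j - i"
    "length V = H.wd (trace Q i) (trace Q j)" "p (val U) = p (val V)"
    "Q = take i Q @ U @ drop j Q"
proof -
  obtain U where U: "U \<in> lists L" "length U = j - i" "Q = take i Q @ U @ drop j Q"
    "trace Q j = trace Q i \<otimes>\<^bsub>H\<^esub> p (val U)"
    by (rule split_word[OF assms])
  have "p (val U) \<in> carrier H" using U by simp
  then obtain V where "V \<in> lists L" "length V = H.wlen (p (val U))" "p (val V) = p (val U)"
    by (rule lift_word)
  moreover have "H.wd (trace Q i) (trace Q j) = H.wlen (p (val U))"
    unfolding U(4) using U(1) Q by (simp add: H.wd_mult_right)
  ultimately show ?thesis using that[OF U(1) _ U(2) _ _ U(3)] by simp
qed

text \<open>Only finitely many pairs of words are involved, and \<open>C\<close> adds up the heights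
  of all of them. For pairs with different images \<open>h\<close> is an arbitrary value, which can
  only enlarge the sum.\<close>

lemma bounded_height:
  "\<exists>C::nat. \<forall>U\<in>lists L. \<forall>V\<in>lists L. length U \<le> R \<longrightarrow> length V \<le> R \<longrightarrow> p (val U) = p (val V) \<longrightarrow>
     (\<exists>c. \<bar>c\<bar> \<le> int C \<and> val U = f c \<otimes> val V)"
proof -
  let ?W = "{ws \<in> lists L. length ws \<le> R}"
  have fin: "finite ?W" using finite_lists_length_le[OF L_finite, of R] by (simp add: lists_eq_set)
  define h where "h U V = (SOME c. val U = f c \<otimes> val V)" for U V
  define C where "C = (\<Sum>U\<in>?W. \<Sum>V\<in>?W. nat \<bar>h U V\<bar>)"
  have "\<exists>c. \<bar>c\<bar> \<le> int C \<and> val U = f c \<otimes> val V"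
    if "U \<in> ?W" "V \<in> ?W" "p (val U) = p (val V)" for U V
  proof -
    have "\<exists>c. val U = f c \<otimes> val V" using same_image that by simp
    then have "val U = f (h U V) \<otimes> val V" unfolding h_def by (rule someI_ex)
    moreover have "nat \<bar>h U V\<bar> \<le> (\<Sum>V\<in>?W. nat \<bar>h U V\<bar>)"
      using fin that by (intro member_le_sum) auto
    moreover have "\<dots> \<le> C" unfolding C_def
      using fin that by (intro member_le_sum[of U ?W "\<lambda>U. \<Sum>V\<in>?W. nat \<bar>h U V\<bar>"]) auto
    ultimately show ?thesis by (intro exI[of _ "h U V"]) auto
  qed
  then show ?thesis by (intro exI[of _ C]) auto
qed

text \<open>Dehn's algorithm: a nonempty word trivial in \<open>H\<close> is not a local geodesic, so it can be
  shortened inside a window of bounded length, at a bounded cost in the kernel.\<close>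

lemma linear_isoperimetric:
  assumes four: "H.four_point \<Delta>" and r: "3 * \<Delta> < 2 * int r" "\<Delta> < int r" "0 \<le> \<Delta>"
  shows "\<exists>E::nat. \<forall>Q\<in>lists L. p (val Q) = \<one>\<^bsub>H\<^esub> \<longrightarrow> (\<exists>c. val Q = f c \<and> \<bar>c\<bar> \<le> int E * int (length Q))"
proof -
  from bounded_height[of "2 * r"] obtain C :: nat where
    C: "\<forall>U\<in>lists L. \<forall>V\<in>lists L. length U \<le> 2 * r \<longrightarrow> length V \<le> 2 * r \<longrightarrow> p (val U) = p (val V) \<longrightarrow>
      (\<exists>c. \<bar>c\<bar> \<le> int C \<and> val U = f c \<otimes> val V)" ..
  have "\<exists>c. val Q = f c \<and> \<bar>c\<bar> \<le> int C * int (length Q)"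
    if "Q \<in> lists L" "p (val Q) = \<one>\<^bsub>H\<^esub>" for Q
    using that
  proof (induction "length Q" arbitrary: Q rule: less_induct)
    case less
    show ?case
    proof (cases "Q = []")
      case True
      then show ?thesis using f_0 by (intro exI[of _ 0]) simp
    next
      case False
      have "trace Q (length Q) = trace Q 0" using less.prems by simp
      then have "\<not> H.local_geodesic (2 * r) (length Q) (trace Q)"
        using H.no_closed_local_geodesic[OF four _ r] False by blast
      then obtain i j where ij: "i \<le> j" "j \<le> length Q" "j \<le> i + 2 * r"
        "H.wd (trace Q i) (trace Q j) \<noteq> j - i"
        using less.prems unfolding H.local_geodesic_def by auto
      then have short: "H.wd (trace Q i) (trace Q j) < j - i"
        using trace_dist_le[OF less.prems(1) ij(1,2)] by simp
      obtain U V where UV: "U \<in> lists L" "V \<in> lists L" "length U = j - i"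
        "length V = H.wd (trace Q i) (trace Q j)" "p (val U) = p (val V)" "Q = take i Q @ U @ drop j Q"
        by (rule shortcut[OF less.prems(1) ij(1,2)])
      have "length U \<le> 2 * r" "length V \<le> 2 * r" using UV(3,4) ij(3) short by linarith+
      with C UV(1,2,5) obtain c where c: "\<bar>c\<bar> \<le> int C" "val U = f c \<otimes> val V" by blast
      let ?A = "take i Q" and ?B = "drop j Q"
      have AB: "?A \<in> lists L" "?B \<in> lists L" using take_drop_L less.prems by auto
      obtain c' where c': "\<bar>c'\<bar> = \<bar>c\<bar>" "val Q = f c' \<otimes> val (?A @ V @ ?B)"
        using replace_subword[OF AB(1) UV(1,2) AB(2) c(2), folded UV(6)] by blast
      have len: "length (?A @ V @ ?B) < length Q" using UV(4) ij short by simp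
      have mem: "?A @ V @ ?B \<in> lists L" using AB UV(2) by auto
      have "p (f c') = \<one>\<^bsub>H\<^esub>" using kernel_p[of "f c'"] by simp
      then have "p (val Q) = p (val (?A @ V @ ?B))" unfolding c'(2) using mem by simp
      then have "p (val (?A @ V @ ?B)) = \<one>\<^bsub>H\<^esub>" using less.prems(2) by simp
      from less.hyps[OF len mem this] obtain e where
        e: "val (?A @ V @ ?B) = f e" "\<bar>e\<bar> \<le> int C * int (length (?A @ V @ ?B))" by blast
      \<comment> \<open>One replacement costs at most \<open>C\<close> and removes at least one
        letter, so the linear bound with slope \<open>C\<close> is preserved.\<close>
      have "\<bar>c' + e\<bar> \<le> int C * int (length (?A @ V @ ?B)) + int C" using c c' e by linarith
      also have "\<dots> = int C * int (Suc (length (?A @ V @ ?B)))" by (simp add: algebra_simps)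
      also have "\<dots> \<le> int C * int (length Q)" using len by (intro mult_left_mono) auto
      finally show ?thesis using c'(2) e(1) by (intro exI[of _ "c' + e"]) (simp add: f_add)
    qed
  qed
  then show ?thesis by blast
qed

end

subsection \<open>The weighted generating set\<close>

text \<open>The condition \<open>4 * r * E < M\<close> makes words of least weight geodesic in
  \<open>H\<close> on windows of length \<open>2 * r\<close>; \<open>12 * E \<le> M\<close> makes
  them quasigeodesic with factor 2 and absorbs the kernel errors of the connecting paths.\<close>

locale weighted_extension = z_extension +
  fixes \<Delta> :: int and r E M :: nat
  assumes four: "H.four_point \<Delta>" and r: "3 * \<Delta> < 2 * int r" "\<Delta> < int r" "0 \<le> \<Delta>"
    and iso: "Q \<in> lists L \<Longrightarrow> p (word_val G Q) = \<one>\<^bsub>H\<^esub> \<Longrightarrow>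
      \<exists>c. word_val G Q = f c \<and> \<bar>c\<bar> \<le> int E * int (length Q)"
    and M: "4 * r * E < M" "12 * E \<le> M" "0 < M"
begin

definition S :: "'a set" where
  "S = L \<union> f ` {- int M..int M}"

lemma normal_form: "g \<in> carrier G \<Longrightarrow> \<exists>T Q. Q \<in> lists L \<and> g = f T \<otimes> val Q"
proof -
  assume g: "g \<in> carrier G"
  then have "p g \<in> carrier H" by simp
  then obtain Q where "Q \<in> lists L" "p (val Q) = p g" by (rule lift_word)
  then show ?thesis using same_image[OF g, of "val Q"] val_closed by metis
qed

lemma generating_S: "generating_set G S"
  unfolding generating_set_def
proof (intro conjI ballI equalityI subsetI)
  show "finite S" using L_finite by (simp add: S_def)
  show carr: "x \<in> carrier G" if "x \<in> S" for x using that L_carrier by (auto simp: S_def)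
  show "inv a \<in> S" if a: "a \<in> S" for a
  proof (cases "a \<in> L")
    case True
    then show ?thesis using L_inv by (simp add: S_def)
  next
    case False
    then obtain c where c: "a = f c" "c \<in> {- int M..int M}" using a by (auto simp: S_def)
    then have "f (- c) \<in> S" unfolding S_def by (intro UnI2 imageI) auto
    then show ?thesis unfolding c(1) f_minus .
  qed
  show "x \<in> carrier G" if "x \<in> generate G S" for x
    by (rule generate_in_carrier[OF _ that]) (use carr in blast)
next
  fix g assume "g \<in> carrier G"
  then obtain T Q where Q: "Q \<in> lists L" "g = f T \<otimes> val Q" using normal_form by blast
  have "f 1 \<in> S" "f (- 1) \<in> S"
    unfolding S_def by (rule UnI2, rule imageI, use M(3) in simp)+
  then have f1: "f 1 \<in> generate G S" "f (- 1) \<in> generate G S"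
    by (auto intro: generate.incl)
  have "f T \<in> generate G S"
  proof (induction T rule: int_induct[of _ 0])
    case base
    show ?case using generate.one by (simp add: f_0)
  next
    case (step1 i)
    show ?case unfolding f_add by (rule generate.eng[OF step1.IH f1(1)])
  next
    case (step2 i)
    have "f (i - 1) = f i \<otimes> f (- 1)" using f_add[of i "- 1"] by simp
    then show ?case using generate.eng[OF step2.IH f1(2)] by simp
  qed
  moreover have "val Q \<in> generate G S"
    using Q(1)
  proof (induction Q)
    case Nil
    show ?case by (simp add: generate.one)
  next
    case (Cons a Q)
    then have "a \<in> generate G S" by (intro generate.incl) (auto simp: S_def)
    then show ?case using Cons generate.eng by simp
  qed
  ultimately show "g \<in> generate G S" unfolding Q(2) by (rule generate.eng)
qed

sublocale GS: generated_group G S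
  using generating_S by unfold_locales

section \<open>Word length in terms of weight\<close>

lemma wlen_f: "\<bar>T\<bar> \<le> int M * int a \<Longrightarrow> GS.wlen (f T) \<le> a"
proof (induction a arbitrary: T)
  case 0
  then show ?case by (simp add: f_0)
next
  case (Suc a)
  \<comment> \<open>Truncating \<open>T\<close> to the interval from \<open>- M\<close> to
    \<open>M\<close> splits off one generator; the rest is 0 or has absolute value smaller by
    \<open>M\<close>.\<close>
  define s where "s = max (- int M) (min (int M) T)"
  have "0 \<le> int M * int a" by simp
  moreover have "\<bar>T\<bar> \<le> int M + int M * int a" using Suc.prems by (simp add: algebra_simps)
  ultimately have "\<bar>T - s\<bar> \<le> int M * int a" unfolding s_def by linarith
  then have "GS.wlen (f (T - s)) \<le> a" by (rule Suc.IH)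
  moreover have "f s \<in> S" by (auto simp: S_def s_def)
  then have "GS.wlen (f s) \<le> 1" using GS.wlen_le[of "[f s]"] by simp
  moreover have "f T = f (T - s) \<otimes> f s" using f_add[of "T - s" s] by simp
  ultimately show ?case using GS.wlen_mult[of "f (T - s)" "f s"] by simp
qed

lemma wlen_val: "Q \<in> lists L \<Longrightarrow> GS.wlen (val Q) \<le> length Q"
  by (rule GS.wlen_le) (auto simp: S_def)

text \<open>The letters of \<open>Q\<close> leave room for \<open>n - length Q\<close> kernel
  generators, each of which covers up to \<open>M\<close> of \<open>T\<close>.\<close>

lemma wlen_normal_form_le:
  assumes Q: "Q \<in> lists L" and w: "int M * int (length Q) + \<bar>T\<bar> \<le> int M * int n"
  shows "GS.wlen (f T \<otimes> val Q) \<le> n"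
proof -
  have "int M * int (length Q) \<le> int M * int n" using w by linarith
  then have len: "length Q \<le> n" using M(3) by simp
  then have "\<bar>T\<bar> \<le> int M * int (n - length Q)" using w by (simp add: of_nat_diff algebra_simps)
  from wlen_f[OF this] wlen_val[OF Q] GS.wlen_mult[of "f T" "val Q"] len Q show ?thesis by simp
qed

text \<open>Induction along a shortest word: a letter of \<open>L\<close> is moved past the kernel
  part, which can only change a sign, and a kernel generator changes \<open>T\<close> by at most
  \<open>M\<close>. So each letter raises the weight by at most \<open>M\<close>.\<close>

lemma normal_form_wlen:
  assumes g: "g \<in> carrier G" and n: "GS.wlen g \<le> n"
  shows "\<exists>T Q. Q \<in> lists L \<and> g = f T \<otimes> val Q \<and> int M * int (length Q) + \<bar>T\<bar> \<le> int M * int n"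
proof -
  have "\<exists>T Q. Q \<in> lists L \<and> val ws = f T \<otimes> val Q \<and>
      int M * int (length Q) + \<bar>T\<bar> \<le> int M * int (length ws)" if "ws \<in> lists S" for ws
    using that
  proof (induction ws)
    case Nil
    show ?case by (intro exI[of _ 0] exI[of _ "[]"]) (simp add: f_0)
  next
    case (Cons a ws)
    then obtain T Q where Q: "Q \<in> lists L" "val ws = f T \<otimes> val Q"
      "int M * int (length Q) + \<bar>T\<bar> \<le> int M * int (length ws)" by auto
    have "a \<in> S" using Cons by simp
    then have "a \<in> L \<or> (\<exists>t. \<bar>t\<bar> \<le> int M \<and> a = f t)"
      unfolding S_def by (auto simp: abs_le_iff)
    then consider "a \<in> L" | t where "\<bar>t\<bar> \<le> int M" "a = f t" by blast
    then show ?case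
    proof cases
      case 1
      then have a: "a \<in> carrier G" using L_carrier by auto
      obtain T' where T': "\<bar>T'\<bar> = \<bar>T\<bar>" "a \<otimes> f T = f T' \<otimes> a" using f_conj[OF a] by blast
      have "val (a # ws) = (a \<otimes> f T) \<otimes> val Q" using Q a by (simp add: m_assoc)
      also have "\<dots> = f T' \<otimes> val (a # Q)" unfolding T' using Q a by (simp add: m_assoc)
      finally show ?thesis using Q 1 T' by (intro exI[of _ T'] exI[of _ "a # Q"]) (auto simp: algebra_simps)
    next
      case 2
      have "val (a # ws) = f (t + T) \<otimes> val Q" using Q 2 by (simp add: f_add m_assoc)
      moreover have "int M * int (length Q) + \<bar>t + T\<bar> \<le> int M * int (length (a # ws))"
        using Q(3) 2(1) by (simp add: algebra_simps)
      ultimately show ?thesis using Q(1) by blast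
    qed
  qed
  moreover obtain ws where "ws \<in> lists S" "length ws = GS.wlen g" "val ws = g" by (rule GS.wlen_word[OF g])
  ultimately obtain T Q where Q: "Q \<in> lists L" "g = f T \<otimes> val Q"
    "int M * int (length Q) + \<bar>T\<bar> \<le> int M * int (GS.wlen g)" by metis
  have "int M * int (GS.wlen g) \<le> int M * int n" using n by (intro mult_left_mono) auto
  then have "int M * int (length Q) + \<bar>T\<bar> \<le> int M * int n" using Q(3) by linarith
  then show ?thesis using Q(1,2) by blast
qed

lemma p_f [simp]: "p (f c) = \<one>\<^bsub>H\<^esub>"
  using kernel_p[of "f c"] by simp

lemma wlen_p_le: "g \<in> carrier G \<Longrightarrow> H.wlen (p g) \<le> GS.wlen g"
proof -
  assume "g \<in> carrier G"
  then obtain T Q where Q: "Q \<in> lists L" "g = f T \<otimes> val Q"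
    "int M * int (length Q) + \<bar>T\<bar> \<le> int M * int (GS.wlen g)" using normal_form_wlen by blast
  then have "int M * int (length Q) \<le> int M * int (GS.wlen g)" by linarith
  then have "length Q \<le> GS.wlen g" using M(3) by simp
  then show ?thesis using wlen_p_val[OF Q(1)] Q(1,2) by simp
qed

lemma wd_p_le: "x \<in> carrier G \<Longrightarrow> y \<in> carrier G \<Longrightarrow> H.wd (p x) (p y) \<le> GS.wd x y"
  using wlen_p_le[of "inv x \<otimes> y"] by (simp add: word_dist_def)

text \<open>This is the isoperimetric inequality for \<open>U\<close> followed by the inverse of
  \<open>V\<close>.\<close>

lemma height_difference:
  assumes "U \<in> lists L" "V \<in> lists L" "p (val U) = p (val V)"
  shows "\<exists>c. val U = f c \<otimes> val V \<and> \<bar>c\<bar> \<le> int E * (int (length U) + int (length V))"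
proof -
  have w: "U @ inverse_word V \<in> lists L" using assms inverse_word by auto
  have v: "val (U @ inverse_word V) = val U \<otimes> inv (val V)"
    using assms inverse_word by (simp add: val_append)
  then have "p (val (U @ inverse_word V)) = \<one>\<^bsub>H\<^esub>" using assms by simp
  from iso[OF w this] obtain c where c: "val U \<otimes> inv (val V) = f c"
    "\<bar>c\<bar> \<le> int E * (int (length U) + int (length V))"
    using v inverse_word(2)[OF assms(2)] by auto
  have "val U = f c \<otimes> val V" unfolding c(1)[symmetric] using assms by (simp add: m_assoc)
  then show ?thesis using c(2) by blast
qed

section \<open>Expressions of least weight\<close>

text \<open>Least weight is finer than least length: the word length of \<open>g\<close> is the
  least weight divided by \<open>M\<close> and rounded up.\<close>

definition minimal :: "'a \<Rightarrow> int \<Rightarrow> 'a list \<Rightarrow> bool" where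
  "minimal g T Q \<longleftrightarrow> Q \<in> lists L \<and> g = f T \<otimes> val Q \<and>
     (\<forall>T' Q'. Q' \<in> lists L \<longrightarrow> g = f T' \<otimes> val Q' \<longrightarrow>
        int M * int (length Q) + \<bar>T\<bar> \<le> int M * int (length Q') + \<bar>T'\<bar>)"

lemma minimal_exists:
  assumes "g \<in> carrier G" shows "\<exists>T Q. minimal g T Q"
proof -
  let ?P = "\<lambda>(T, Q). Q \<in> lists L \<and> g = f T \<otimes> val Q"
  let ?w = "\<lambda>(T, Q). M * length (Q :: 'a list) + nat \<bar>T\<bar>"
  obtain T0 Q0 where "?P (T0, Q0)" using normal_form[OF assms] by auto
  then obtain x where x: "?P x" "\<And>y. ?P y \<Longrightarrow> ?w x \<le> ?w y"
    using ex_has_least_nat[of ?P "(T0, Q0)" ?w] by blast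
  obtain T Q where TQ: "x = (T, Q)" by (cases x)
  have "int M * int (length Q) + \<bar>T\<bar> \<le> int M * int (length Q') + \<bar>T'\<bar>"
    if "Q' \<in> lists L" "g = f T' \<otimes> val Q'" for T' Q'
  proof -
    have "M * length Q + nat \<bar>T\<bar> \<le> M * length Q' + nat \<bar>T'\<bar>" using x(2)[of "(T', Q')"] that TQ by simp
    then have "int (M * length Q + nat \<bar>T\<bar>) \<le> int (M * length Q' + nat \<bar>T'\<bar>)" by (rule zle_int[THEN iffD2])
    then show ?thesis by simp
  qed
  moreover have "Q \<in> lists L" "g = f T \<otimes> val Q" using x(1) TQ by auto
  ultimately show ?thesis unfolding minimal_def by blast
qed

lemma minimal_weight:
  assumes "minimal g T Q" "GS.wlen g \<le> n"
  shows "int M * int (length Q) + \<bar>T\<bar> \<le> int M * int n"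
proof -
  have "g \<in> carrier G" using assms(1) by (auto simp: minimal_def)
  from normal_form_wlen[OF this assms(2)] obtain T' Q' where
    "Q' \<in> lists L" "g = f T' \<otimes> val Q'" "int M * int (length Q') + \<bar>T'\<bar> \<le> int M * int n" by blast
  moreover from this(1,2) have "int M * int (length Q) + \<bar>T\<bar> \<le> int M * int (length Q') + \<bar>T'\<bar>"
    using assms(1) unfolding minimal_def by blast
  ultimately show ?thesis by linarith
qed

text \<open>Replacing the subword by a geodesic saves \<open>M\<close> per removed letter and
  changes the kernel part by at most \<open>E\<close> times the number of letters in both words;
  minimality rules out a net gain.\<close>

lemma minimal_segment:
  assumes min: "minimal g T Q" and ij: "i \<le> j" "j \<le> length Q"
  defines "d \<equiv> H.wd (trace Q i) (trace Q j)"
  shows "int M * (int j - int i) \<le> int M * int d + int E * (int j - int i + int d)"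
proof -
  have Q: "Q \<in> lists L" "g = f T \<otimes> val Q" using min by (auto simp: minimal_def)
  obtain U V where UV: "U \<in> lists L" "V \<in> lists L" "length U = j - i" "length V = d"
    "p (val U) = p (val V)" "Q = take i Q @ U @ drop j Q"
    unfolding d_def by (rule shortcut[OF Q(1) ij])
  obtain c where c: "val U = f c \<otimes> val V" "\<bar>c\<bar> \<le> int E * (int (length U) + int (length V))"
    using height_difference[OF UV(1,2,5)] by blast
  let ?Q = "take i Q @ V @ drop j Q"
  have AB: "take i Q \<in> lists L" "drop j Q \<in> lists L" using take_drop_L Q by auto
  then have Q': "?Q \<in> lists L" using UV(2) by auto
  obtain c' where c': "\<bar>c'\<bar> = \<bar>c\<bar>" "val Q = f c' \<otimes> val ?Q"
    using replace_subword[OF AB(1) UV(1,2) AB(2) c(1), folded UV(6)] by blast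
  have "g = f (T + c') \<otimes> val ?Q" using Q(2) c'(2) Q' by (simp add: f_add m_assoc)
  then have "int M * int (length Q) + \<bar>T\<bar> \<le> int M * int (length ?Q) + \<bar>T + c'\<bar>"
    using min Q' unfolding minimal_def by blast
  moreover have len: "int (length ?Q) = int (length Q) - (int j - int i) + int d"
    using ij UV(4) by (simp add: of_nat_diff)
  have "int M * int (length ?Q) = int M * int (length Q) - int M * (int j - int i) + int M * int d"
    unfolding len by (simp add: algebra_simps)
  moreover have "\<bar>T + c'\<bar> \<le> \<bar>T\<bar> + int E * (int j - int i + int d)"
    using c'(1) c(2) UV(3,4) ij by (simp add: of_nat_diff)
  ultimately show ?thesis by linarith
qed

text \<open>For \<open>n\<close> letters spanning distance \<open>d\<close> in \<open>H\<close>, the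
  previous inequality and \<open>12 * E \<le> M\<close> give
  \<open>11 * n \<le> 13 * d\<close>.\<close>

lemma minimal_quasigeodesic:
  assumes min: "minimal g T Q" and ij: "i \<le> j" "j \<le> length Q"
  shows "j - i \<le> 2 * H.wd (trace Q i) (trace Q j)"
proof -
  define d where "d = int (H.wd (trace Q i) (trace Q j))"
  define n where "n = int j - int i"
  have nn: "0 \<le> n" "0 \<le> d" using ij by (auto simp: n_def d_def)
  have seg: "int M * n \<le> int M * d + int E * (n + d)"
    using minimal_segment[OF assms] by (simp add: n_def d_def)
  have "int (12 * E) * (n + d) \<le> int M * (n + d)"
    using M(2) nn by (intro mult_right_mono) auto
  then have "12 * (int E * (n + d)) \<le> int M * (n + d)" by simp
  with seg have "int M * (11 * n) \<le> int M * (13 * d)" by (simp add: algebra_simps)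
  then have "11 * n \<le> 13 * d" using M(3) by simp
  then have "n \<le> 2 * d" using nn by linarith
  then show ?thesis using ij by (simp add: n_def d_def)
qed

text \<open>Inside a window of \<open>2 * r\<close> letters a shortcut would save at least
  \<open>M\<close>, while its kernel error is at most \<open>4 * r * E\<close>, which is less than
  \<open>M\<close>.\<close>

lemma minimal_local_geodesic:
  assumes min: "minimal g T Q"
  shows "H.local_geodesic (2 * r) (length Q) (trace Q)"
  unfolding H.local_geodesic_def
proof (intro conjI allI impI)
  have Q: "Q \<in> lists L" using min by (auto simp: minimal_def)
  show "trace Q i \<in> carrier H" for i using Q by simp
  fix i j assume ij: "i \<le> j" "j \<le> length Q" "j \<le> i + 2 * r"
  let ?d = "H.wd (trace Q i) (trace Q j)"
  show "?d = j - i"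
  proof (rule ccontr)
    assume "?d \<noteq> j - i"
    then have d: "int ?d + 1 \<le> int j - int i" using trace_dist_le[OF Q ij(1,2)] ij(1) by linarith
    have "int M * (int ?d + 1) \<le> int M * (int j - int i)" using d by (intro mult_left_mono) auto
    moreover have "int E * (int j - int i + int ?d) \<le> int E * (4 * int r)"
      using d ij by (intro mult_left_mono) auto
    ultimately have "int M \<le> int E * (4 * int r)"
      using minimal_segment[OF min ij(1,2)] by (simp add: algebra_simps)
    then have "int M \<le> int (4 * r * E)" by (simp add: mult.commute mult.left_commute)
    then show False using M(1) by linarith
  qed
qed

text \<open>The lengths of the tails enter with the factor \<open>E\<close> only, whereas going back along them lowers
  the weight with the factor \<open>M\<close>.\<close>

lemma strip_tails:
  assumes y: "y \<in> carrier G" "y' \<in> carrier G" and B: "B \<in> lists L" "B' \<in> lists L" and w: "w \<in> lists L"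
    and m: "GS.wd (y \<otimes> val B) (y' \<otimes> val B') \<le> m" and pw: "p (val w) = p (inv y \<otimes> y')"
  shows "\<exists>t. inv y \<otimes> y' = f t \<otimes> val w \<and>
    \<bar>t\<bar> \<le> int M * int m + int E * (int (length B) + int m + int (length B') + int (length w))"
proof -
  let ?g = "y \<otimes> val B" and ?g' = "y' \<otimes> val B'"
  have "GS.wlen (inv ?g \<otimes> ?g') \<le> m" using m by (simp add: word_dist_def)
  then obtain t0 W where W: "W \<in> lists L" "inv ?g \<otimes> ?g' = f t0 \<otimes> val W"
    "int M * int (length W) + \<bar>t0\<bar> \<le> int M * int m"
    using normal_form_wlen[of "inv ?g \<otimes> ?g'" m] y B by auto
  have "0 \<le> int M * int (length W)" by simp
  then have t0: "\<bar>t0\<bar> \<le> int M * int m" using W(3) by linarith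
  have "int M * int (length W) \<le> int M * int m" using W(3) by linarith
  then have lW: "length W \<le> m" using M(3) by simp
  \<comment> \<open>Up to a kernel element, \<open>U\<close> is the detour from \<open>y\<close>
    along \<open>B\<close>, across, and back along \<open>B'\<close>; its image in \<open>H\<close>
    is that of \<open>w\<close>.\<close>
  define U where "U = B @ W @ inverse_word B'"
  have U: "U \<in> lists L" using B W inverse_word by (auto simp: U_def)
  obtain t1 where t1: "\<bar>t1\<bar> = \<bar>t0\<bar>" "val B \<otimes> f t0 = f t1 \<otimes> val B" using f_conj[of "val B" t0] B by auto
  have "inv y \<otimes> y' = val B \<otimes> (inv ?g \<otimes> ?g') \<otimes> inv (val B')"
    using y B by (simp add: inv_mult_group m_assoc)
  also have "\<dots> = (val B \<otimes> f t0) \<otimes> val W \<otimes> inv (val B')"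
    unfolding W(2) using B W by (simp add: m_assoc)
  also have "\<dots> = f t1 \<otimes> val U"
    unfolding t1(2) U_def using B W inverse_word by (simp add: val_append m_assoc)
  finally have yU: "inv y \<otimes> y' = f t1 \<otimes> val U" .
  then have "p (val U) = p (val w)" using pw U by simp
  then obtain c where c: "val U = f c \<otimes> val w" "\<bar>c\<bar> \<le> int E * (int (length U) + int (length w))"
    using height_difference[OF U w] by blast
  have "inv y \<otimes> y' = f (t1 + c) \<otimes> val w" unfolding yU c(1) using w by (simp add: f_add m_assoc)
  moreover have "int E * (int (length U) + int (length w)) \<le>
      int E * (int (length B) + int m + int (length B') + int (length w))"
    using lW inverse_word(2)[OF B(2)] by (intro mult_left_mono) (auto simp: U_def)
  then have "\<bar>t1 + c\<bar> \<le> int M * int m + int E * (int (length B) + int m + int (length B') + int (length w))"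
    using t0 t1(1) c(2) by linarith
  ultimately show ?thesis by blast
qed

section \<open>Joining two points of a sphere inside the ball\<close>

lemma normal_form_split:
  assumes "Q \<in> lists L"
  shows "f T \<otimes> val (take i Q) \<otimes> val (drop i Q) = f T \<otimes> val Q"
  using val_append[of "take i Q" "drop i Q"] take_drop_L[OF assms] by (simp add: m_assoc)

text \<open>The path goes back from \<open>g\<close> to \<open>y\<close>, across to
  \<open>y'\<close> and forward to \<open>g'\<close>. Dropping \<open>j\<close> letters puts
  \<open>y\<close> at depth \<open>j\<close>, and \<open>j = 2 * (m + D)\<close> is large enough for
  the crossing to have length at most \<open>j\<close>.\<close>

lemma connected_long:
  assumes g: "minimal g T P" "GS.wlen g = n" and g': "minimal g' T' P'" "GS.wlen g' = n"
    and m: "GS.wd g g' \<le> m"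
    and D: "D = 3 * m + 5 * nat \<Delta>" and j: "j = 2 * (m + D)" "j \<le> length P"
  shows "\<exists>k\<le>2 * j + 2 * (D + j + m). edge_path_in G S (GS.ball n) g g' k"
proof -
  have P: "P \<in> lists L" "g = f T \<otimes> val P" and P': "P' \<in> lists L" "g' = f T' \<otimes> val P'"
    using g g' by (auto simp: minimal_def)
  have carr: "g \<in> carrier G" "g' \<in> carrier G" using P P' by auto
  have W: "int M * int (length P) + \<bar>T\<bar> \<le> int M * int n" "int M * int (length P') + \<bar>T'\<bar> \<le> int M * int n"
    using minimal_weight g g' by auto
  have pg: "p g = p (val P)" "p g' = p (val P')" using P P' by auto
  have pm: "H.wd (p g) (p g') \<le> m" using wd_p_le[OF carr] m by linarith
  define i where "i = length P - j"
  have "\<exists>k\<le>length P'. int (H.wd (trace P i) (trace P' k)) \<le> 3 * int m + 5 * \<Delta>"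
    by (rule H.local_geodesics_fellow_travel[OF four minimal_local_geodesic[OF g(1)]
          minimal_local_geodesic[OF g'(1)] r])
      (use pm pg in \<open>auto simp: i_def\<close>)
  then obtain k where k: "k \<le> length P'" "H.wd (trace P i) (trace P' k) \<le> D"
    using r(3) unfolding D by (auto simp: of_nat_diff)
  define j' where "j' = length P' - k"
  have tc: "trace P i \<in> carrier H" "trace P' k \<in> carrier H" "p g \<in> carrier H" "p g' \<in> carrier H"
    using P P' carr by auto
  have "H.wd (trace P i) (p g) \<le> j"
    using trace_dist_le[OF P(1), of i "length P"] j(2) pg by (simp add: i_def)
  moreover have "H.wd (trace P' k) (trace P i) = H.wd (trace P i) (trace P' k)"
    by (rule H.wd_commute[OF tc(2,1)])
  ultimately have dist: "H.wd (trace P' k) (p g') \<le> D + j + m"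
    using H.wd_triangle[OF tc(2,1,4)] H.wd_triangle[OF tc(1,3,4)] k(2) pm by linarith
  have "j' \<le> 2 * H.wd (trace P' k) (p g')"
    using minimal_quasigeodesic[OF g'(1) k(1)] pg by (simp add: j'_def)
  also have "\<dots> \<le> 2 * (D + j + m)" by (rule mult_le_mono2[OF dist])
  finally have j': "j' \<le> 2 * (D + j + m)" .
  define y where "y = f T \<otimes> val (take i P)"
  define y' where "y' = f T' \<otimes> val (take k P')"
  have sub: "take i P \<in> lists L" "drop i P \<in> lists L" "take k P' \<in> lists L" "drop k P' \<in> lists L"
    using take_drop_L P P' by auto
  have y: "y \<in> carrier G" "y' \<in> carrier G" using sub by (auto simp: y_def y'_def)
  have gy: "g = y \<otimes> val (drop i P)" "g' = y' \<otimes> val (drop k P')"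
    unfolding y_def y'_def P(2) P'(2) using normal_form_split P(1) P'(1) by auto
  have len: "length (drop i P) = j" "length (drop k P') = j'" using j(2) by (auto simp: i_def j'_def)
  have py: "p y = trace P i" "p y' = trace P' k"
    using sub by (auto simp: y_def y'_def trace_def)
  obtain w where w: "w \<in> lists L" "length w = H.wlen (p (inv y \<otimes> y'))" "p (val w) = p (inv y \<otimes> y')"
    by (rule lift_word[of "p (inv y \<otimes> y')"]) (use y in auto)
  have "length w = H.wd (trace P i) (trace P' k)" using w(2) y py by (simp add: word_dist_def)
  then have lw: "length w \<le> D" using k(2) by simp
  obtain t where t: "inv y \<otimes> y' = f t \<otimes> val w"
    "\<bar>t\<bar> \<le> int M * int m + int E * (int j + int m + int j' + int (length w))"
    using strip_tails[OF y sub(2,4) w(1) _ w(3), of m] m gy len by auto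
  have "GS.wlen (f t \<otimes> val w) \<le> j"
  proof (rule wlen_normal_form_le[OF w(1)])
    \<comment> \<open>The sum of the lengths is at most \<open>3 * (j + m + D)\<close>, which is
      \<open>9 * (m + D)\<close>; by \<open>12 * E \<le> M\<close> the error fits into
      \<open>M * (m + D)\<close>.\<close>
    have "int E * (int j + int m + int j' + int (length w)) \<le> int E * (9 * (int m + int D))"
      using lw j' j(1) by (intro mult_left_mono) auto
    moreover have "int E * (9 * (int m + int D)) \<le> int (12 * E) * (int m + int D)"
      by (simp add: algebra_simps)
    moreover have "int (12 * E) * (int m + int D) \<le> int M * (int m + int D)"
      using M(2) by (intro mult_right_mono) auto
    ultimately have "int E * (int j + int m + int j' + int (length w)) \<le> int M * (int m + int D)"
      by linarith
    moreover have "int M * int (length w) \<le> int M * int D" using lw by (intro mult_left_mono) auto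
    \<comment> \<open>The three summands pay for the error just bounded, for the term
      \<open>M * m\<close> from \<open>strip_tails\<close> and for the letters of
      \<open>w\<close>.\<close>
    moreover have "int M * int j = int M * (int m + int D) + int M * int m + int M * int D"
      using j(1) by (simp add: algebra_simps)
    ultimately show "int M * int (length w) + \<bar>t\<bar> \<le> int M * int j" using t(2) by linarith
  qed
  then have yy: "GS.wd y y' \<le> j" using t(1) by (simp add: word_dist_def)
  have "length P \<le> n" "length P' \<le> n"
  proof -
    have "int M * int (length P) \<le> int M * int n" "int M * int (length P') \<le> int M * int n" using W by linarith+
    then show "length P \<le> n" "length P' \<le> n" using M(3) by auto
  qed
  then have jn: "j \<le> n" "j' \<le> n" using j(2) by (auto simp: j'_def)
  \<comment> \<open>Each dropped letter lowers the weight by \<open>M\<close>, hence the bound on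
    the length by one.\<close>
  have "GS.wlen y \<le> n - j" unfolding y_def
    by (rule wlen_normal_form_le[OF sub(1)])
      (use W(1) j(2) jn(1) in \<open>simp add: i_def of_nat_diff algebra_simps\<close>)
  moreover have "GS.wlen y' \<le> n - j'" unfolding y'_def
    by (rule wlen_normal_form_le[OF sub(3)])
      (use W(2) k(1) jn(2) in \<open>simp add: j'_def of_nat_diff algebra_simps\<close>)
  moreover have "GS.wd y g \<le> j" "GS.wd y' g' \<le> j'"
    using wlen_val[OF sub(2)] wlen_val[OF sub(4)] GS.wd_mult_right[OF y(1)] GS.wd_mult_right[OF y(2)]
      sub gy len by auto
  ultimately have le: "GS.wlen y + GS.wd y g \<le> n" "GS.wlen y + GS.wd y y' \<le> n"
    "GS.wlen y' + GS.wd y' g' \<le> n" "GS.wd y g + GS.wd y y' + GS.wd y' g' \<le> 2 * j + 2 * (D + j + m)"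
    using yy jn j' by linarith+
  have "edge_path_in G S (GS.ball n) g g' (GS.wd y g + GS.wd y y' + GS.wd y' g')"
    by (rule GS.edge_path_trans[OF GS.edge_path_in_ball(1)[OF y(2) carr(2) le(3)]
          GS.edge_path_trans[OF GS.edge_path_in_ball(1)[OF y le(2)]
            GS.edge_path_in_ball(2)[OF y(1) carr(1) le(1)]]])
  then show ?thesis using le(4) by blast
qed

text \<open>Left multiplication by one kernel element lowers both kernel parts by
  \<open>M * m\<close> and keeps the distance of the two points. The path goes down, across at depth
  \<open>m\<close> and up again, each leg having length at most \<open>m\<close>.\<close>

lemma connected_same_sign:
  assumes Q: "Q \<in> lists L" "Q' \<in> lists L" and g: "g = f T \<otimes> val Q" "g' = f T' \<otimes> val Q'"
    and W: "int M * int (length Q) + \<bar>T\<bar> \<le> int M * int n" "int M * int (length Q') + \<bar>T'\<bar> \<le> int M * int n"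
    and m: "GS.wd g g' \<le> m" and \<sigma>: "\<bar>\<sigma>\<bar> = 1" "int M * int m \<le> \<sigma> * T" "int M * int m \<le> \<sigma> * T'"
  shows "\<exists>k\<le>3 * m. edge_path_in G S (GS.ball n) g g' k"
proof -
  \<comment> \<open>The sign is opposite to that of \<open>T\<close> and \<open>T'\<close>, so that
    both absolute values drop by \<open>M * m\<close>.\<close>
  define c where "c = - (\<sigma> * (int M * int m))"
  have carr: "g \<in> carrier G" "g' \<in> carrier G" using Q g by auto
  have cases: "\<sigma> = 1 \<or> \<sigma> = - 1" using \<sigma>(1) by linarith
  have cm: "\<bar>c\<bar> = int M * int m" using \<sigma>(1) by (simp add: c_def abs_mult)
  have red: "GS.wlen (f c \<otimes> g) \<le> n - m \<and> GS.wd g (f c \<otimes> g) \<le> m \<and> m \<le> n"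
    if Q: "Q \<in> lists L" and g: "g = f T \<otimes> val Q" and W: "int M * int (length Q) + \<bar>T\<bar> \<le> int M * int n"
      and T: "int M * int m \<le> \<sigma> * T" for g T Q
  proof -
    have Tc: "\<bar>T + c\<bar> = \<bar>T\<bar> - int M * int m" "int M * int m \<le> \<bar>T\<bar>"
    proof -
      have "0 \<le> int M * int m" by simp
      then show "\<bar>T + c\<bar> = \<bar>T\<bar> - int M * int m" "int M * int m \<le> \<bar>T\<bar>"
        using cases T unfolding c_def by (elim disjE; simp; linarith)+
    qed
    have "0 \<le> int M * int (length Q)" by simp
    then have "int M * int m \<le> int M * int n" using W Tc by linarith
    then have mn: "m \<le> n" using M(3) by simp
    have "f c \<otimes> g = f (T + c) \<otimes> val Q" using g Q by (simp add: f_add m_assoc add.commute[of T])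
    moreover have "GS.wlen (f (T + c) \<otimes> val Q) \<le> n - m"
      by (rule wlen_normal_form_le[OF Q]) (use W Tc mn in \<open>simp add: of_nat_diff algebra_simps\<close>)
    moreover have "GS.wd g (f c \<otimes> g) \<le> m"
    proof -
      have gc: "g \<in> carrier G" using g Q by simp
      \<comment> \<open>The word metric is left invariant, so the left factor \<open>f c\<close> is
        turned by conjugation into a right factor \<open>f c'\<close> of the same size.\<close>
      obtain c' where c': "\<bar>c'\<bar> = \<bar>c\<bar>" "inv g \<otimes> f c = f c' \<otimes> inv g" using f_conj[of "inv g" c] gc by auto
      have "inv g \<otimes> (f c \<otimes> g) = f c'" using c'(2) gc by (simp flip: m_assoc) (simp add: m_assoc)
      then show ?thesis using wlen_f[of c' m] c'(1) cm by (simp add: word_dist_def)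
    qed
    ultimately show ?thesis using mn by simp
  qed
  let ?y = "f c \<otimes> g" and ?y' = "f c \<otimes> g'"
  have y: "?y \<in> carrier G" "?y' \<in> carrier G" using carr by auto
  have r1: "GS.wlen ?y \<le> n - m" "GS.wd g ?y \<le> m" "m \<le> n" using red[OF Q(1) g(1) W(1) \<sigma>(2)] by auto
  have r2: "GS.wlen ?y' \<le> n - m" "GS.wd g' ?y' \<le> m" using red[OF Q(2) g(2) W(2) \<sigma>(3)] by auto
  have comm: "GS.wd ?y g = GS.wd g ?y" "GS.wd ?y' g' = GS.wd g' ?y'"
    by (rule GS.wd_commute; use y carr in simp)+
  have yy: "GS.wd ?y ?y' \<le> m" using m GS.wd_left_cancel[of "f c" g g'] carr by simp
  have e: "edge_path_in G S (GS.ball n) g ?y (GS.wd ?y g)"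
    by (rule GS.edge_path_in_ball(2)[OF y(1) carr(1)]) (use r1 comm in linarith)
  have e': "edge_path_in G S (GS.ball n) ?y ?y' (GS.wd ?y ?y')"
    by (rule GS.edge_path_in_ball(1)[OF y]) (use r1 yy in linarith)
  have e'': "edge_path_in G S (GS.ball n) ?y' g' (GS.wd ?y' g')"
    by (rule GS.edge_path_in_ball(1)[OF y(2) carr(2)]) (use r1 r2 comm in linarith)
  have "edge_path_in G S (GS.ball n) g g' (GS.wd ?y g + GS.wd ?y ?y' + GS.wd ?y' g')"
    by (rule GS.edge_path_trans[OF e'' GS.edge_path_trans[OF e' e]])
  moreover have "GS.wd ?y g + GS.wd ?y ?y' + GS.wd ?y' g' \<le> 3 * m" using r1 r2 yy comm by linarith
  ultimately show ?thesis by blast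
qed

text \<open>Short words on a large sphere leave most of the weight to the kernel parts. These differ
  by less than their size, so they have the same sign and the descent in the kernel direction
  applies.\<close>

lemma connected_short:
  assumes g: "minimal g T P" "GS.wlen g = n" and g': "minimal g' T' P'" "GS.wlen g' = n"
    and m: "GS.wd g g' \<le> m" and j: "length P \<le> j" "length P' \<le> j" and n: "3 * j + 2 * m + 1 < n"
  shows "\<exists>k\<le>3 * m. edge_path_in G S (GS.ball n) g g' k"
proof -
  have P: "P \<in> lists L" "g = f T \<otimes> val P" and P': "P' \<in> lists L" "g' = f T' \<otimes> val P'"
    using g g' by (auto simp: minimal_def)
  have W: "int M * int (length P) + \<bar>T\<bar> \<le> int M * int n" "int M * int (length P') + \<bar>T'\<bar> \<le> int M * int n"
    using minimal_weight g g' by auto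
  have big: "int M * (2 * int j + 2 * int m) < \<bar>T\<bar>"
    if "Q \<in> lists L" "GS.wlen (f T \<otimes> val Q) = n" "length Q \<le> j" for T Q
  proof -
    \<comment> \<open>Otherwise the element would have length at most \<open>n - 1\<close>.\<close>
    have "\<not> int M * int (length Q) + \<bar>T\<bar> \<le> int M * int (n - 1)"
      using wlen_normal_form_le[OF that(1), of T "n - 1"] that(2) n by auto
    moreover have "int M * (3 * int j + 2 * int m) \<le> int M * int (n - 1)"
      using n by (intro mult_left_mono) auto
    moreover have "int M * int (length Q) \<le> int M * int j" using that(3) by (intro mult_left_mono) auto
    ultimately show ?thesis by (simp add: algebra_simps)
  qed
  have T: "int M * (2 * int j + 2 * int m) < \<bar>T\<bar>" "int M * (2 * int j + 2 * int m) < \<bar>T'\<bar>"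
    using big[OF P(1)] big[OF P'(1)] P P' g g' j by auto
  have "inv (f T) \<otimes> f T' = f (T' - T)" using f_add[of "- T" T'] f_minus[of T] by simp
  \<comment> \<open>Stripping all of \<open>P\<close> and \<open>P'\<close>, with the empty word for
    \<open>w\<close>, compares the pure kernel elements \<open>f T\<close> and
    \<open>f T'\<close>.\<close>
  then obtain t where t: "f (T' - T) = f t"
    "\<bar>t\<bar> \<le> int M * int m + int E * (int (length P) + int m + int (length P'))"
    using strip_tails[of "f T" "f T'" P P' "[]" m] m P P' by auto
  then have tT: "t = T' - T" using f_inj by (simp add: inj_eq)
  have "int E * (int (length P) + int m + int (length P')) \<le> int M * (2 * int j + int m)"
    using j M(2) by (intro mult_mono) auto
  then have diff: "\<bar>T' - T\<bar> \<le> int M * (2 * int j + 2 * int m)" using t(2) tT by (simp add: algebra_simps)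
  have mono: "int M * int m \<le> int M * (2 * int j + 2 * int m)" by (intro mult_left_mono) auto
  have "0 \<le> int M * (2 * int j + 2 * int m)" by simp
  then consider "0 < T" "0 < T'" | "T < 0" "T' < 0" using T diff by linarith
  then show ?thesis
  proof cases
    case 1
    then show ?thesis using connected_same_sign[OF P(1) P'(1) P(2) P'(2) W m, of 1] T mono by simp
  next
    case 2
    then show ?thesis using connected_same_sign[OF P(1) P'(1) P(2) P'(2) W m, of "- 1"] T mono by simp
  qed
qed

theorem almost_convex_S: "almost_convex G S"
  unfolding almost_convex_def
proof
  fix m
  define D where "D = 3 * m + 5 * nat \<Delta>"
  define j where "j = 2 * (m + D)"
  \<comment> \<open>The sum of the bounds for a long word, for two short words and for a small
    sphere; in the last case the path passes through the identity.\<close>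
  define K where "K = 2 * j + 2 * (D + j + m) + 3 * m + 2 * (3 * j + 2 * m + 1)"
  show "almost_convex_at G S m"
  proof (rule GS.almost_convex_atI[of m K])
    fix n g g'
    assume c: "g \<in> carrier G" "g' \<in> carrier G" and n: "GS.wlen g = n" "GS.wlen g' = n" and m: "GS.wd g g' \<le> m"
    obtain T P where P: "minimal g T P" using minimal_exists[OF c(1)] by blast
    obtain T' P' where P': "minimal g' T' P'" using minimal_exists[OF c(2)] by blast
    consider "j \<le> length P" | "j \<le> length P'" | "length P \<le> j" "length P' \<le> j" "3 * j + 2 * m + 1 < n"
      | "n \<le> 3 * j + 2 * m + 1" by linarith
    then show "\<exists>k\<le>K. edge_path_in G S (GS.ball n) g g' k"
    proof cases
      case 1
      from connected_long[OF P n(1) P' n(2) m D_def j_def 1] obtain k where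
        "k \<le> 2 * j + 2 * (D + j + m)" "edge_path_in G S (GS.ball n) g g' k" by blast
      then show ?thesis by (intro exI[of _ k]) (simp add: K_def)
    next
      case 2
      have m': "GS.wd g' g \<le> m" using m GS.wd_commute[OF c] by linarith
      from connected_long[OF P' n(2) P n(1) m' D_def j_def 2] obtain k where
        "k \<le> 2 * j + 2 * (D + j + m)" "edge_path_in G S (GS.ball n) g' g k" by blast
      then show ?thesis using GS.edge_path_sym by (intro exI[of _ k]) (simp add: K_def)
    next
      case 3
      from connected_short[OF P n(1) P' n(2) m 3] obtain k where
        "k \<le> 3 * m" "edge_path_in G S (GS.ball n) g g' k" by blast
      then show ?thesis by (intro exI[of _ k]) (simp add: K_def)
    next
      case 4
      have w: "GS.wd \<one> g = n" "GS.wd \<one> g' = n" using n c by auto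
      have "edge_path_in G S (GS.ball n) g \<one> n" "edge_path_in G S (GS.ball n) \<one> g' n"
        using GS.edge_path_in_ball(2)[of \<one> g n] GS.edge_path_in_ball(1)[of \<one> g' n] c w by auto
      then have "edge_path_in G S (GS.ball n) g g' (n + n)" by (rule GS.edge_path_trans[rotated])
      then show ?thesis using 4 by (intro exI[of _ "n + n"]) (simp add: K_def)
    qed
  qed
qed

end

section \<open>Choice of the lifts and of the constants\<close>

theorem mainTheorem3:
  fixes G :: "('a, 'c) monoid_scheme" and H :: "('b, 'd) monoid_scheme"
    and f :: "int \<Rightarrow> 'a" and p :: "'a \<Rightarrow> 'b"
  assumes "word_hyperbolic H"
    and "short_exact integer_group G H f p"
  shows "\<exists>S. generating_set G S \<and> almost_convex G S"
proof -
  interpret G: group G using assms(2) by (simp add: short_exact_def)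
  obtain X \<delta> where X: "group H" "generating_set H X"
    and thin: "thin_triangles (cayley_graph H X) (cayley_dist H X) \<delta>"
    using assms(1) by (auto simp: word_hyperbolic_def)
  interpret H: generated_group H X
    using X by (simp add: generated_group_def generated_group_axioms_def)
  have f: "f \<in> hom integer_group G" "inj f" and p: "p \<in> hom G H" "p ` carrier G = carrier H"
    and ker: "range f = kernel G H p"
    using assms(2) by (auto simp: short_exact_def mon_def epi_def)
  interpret p: group_hom G H p using p(1) by unfold_locales
  define \<sigma> where "\<sigma> x = (SOME g. g \<in> carrier G \<and> p g = x)" for x
  have \<sigma>: "\<sigma> x \<in> carrier G" "p (\<sigma> x) = x" if "x \<in> X" for x
  proof -
    have "x \<in> p ` carrier G" unfolding p(2) using that H.S_carrier by (rule rev_subsetD)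
    then have "\<exists>g. g \<in> carrier G \<and> p g = x" by blast
    from someI_ex[OF this] show "\<sigma> x \<in> carrier G" "p (\<sigma> x) = x" unfolding \<sigma>_def by simp_all
  qed
  \<comment> \<open>The chosen lift of an inverse need not be the inverse of the lift, so these
    inverses are added; they still lie over \<open>X\<close>.\<close>
  define L where "L = \<sigma> ` X \<union> (\<lambda>x. inv\<^bsub>G\<^esub> (\<sigma> x)) ` X"
  interpret z_extension G H X f p L
  proof unfold_locales
    show "f a \<in> carrier G" for a using f(1) by (auto simp: hom_def)
    show "f (a + b) = f a \<otimes>\<^bsub>G\<^esub> f b" for a b using f(1) by (simp add: hom_def)
    show "inj f" by (rule f(2))
    show "p \<in> hom G H" by (rule p(1))
    show "p g = \<one>\<^bsub>H\<^esub> \<longleftrightarrow> g \<in> range f" if "g \<in> carrier G" for g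
      using that by (simp add: ker kernel_def)
    show "finite L" using X(2) by (simp add: L_def generating_set_def)
    show "L \<subseteq> carrier G" using \<sigma>(1) by (auto simp: L_def)
    show "inv\<^bsub>G\<^esub> s \<in> L" if "s \<in> L" for s using that \<sigma>(1) by (auto simp: L_def)
    have "p ` \<sigma> ` X = X" unfolding image_image using \<sigma>(2) by simp
    moreover have "p (inv\<^bsub>G\<^esub> (\<sigma> x)) \<in> X" if "x \<in> X" for x
      using \<sigma>[OF that] H.S_inv[OF that] by simp
    ultimately show "p ` L = X" unfolding L_def image_Un by blast
  qed
  define \<Delta> where "\<Delta> = 6 * int (nat \<lceil>\<delta> + 2\<rceil>) + 2"
  have four: "H.four_point \<Delta>"
    unfolding \<Delta>_def by (rule H.four_pointI[OF H.thin_triangles_vertices[OF thin]])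
  \<comment> \<open>As \<open>\<Delta>\<close> is positive, twice its value satisfies both strict
    inequalities required of \<open>r\<close>.\<close>
  define r where "r = nat (2 * \<Delta>)"
  have "0 < \<Delta>" by (simp add: \<Delta>_def)
  then have r: "3 * \<Delta> < 2 * int r" "\<Delta> < int r" "0 \<le> \<Delta>" by (auto simp: r_def)
  from linear_isoperimetric[OF four r] obtain E :: nat where
    E: "\<forall>Q\<in>lists L. p (word_val G Q) = \<one>\<^bsub>H\<^esub> \<longrightarrow>
      (\<exists>c. word_val G Q = f c \<and> \<bar>c\<bar> \<le> int E * int (length Q))" ..
  \<comment> \<open>The sum meets both lower bounds on \<open>M\<close>, and the \<open>1\<close>
    makes the first strict and \<open>M\<close> positive.\<close>
  interpret weighted_extension G H X f p L \<Delta> r E "4 * r * E + 12 * E + 1"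
    by unfold_locales (use four r E in auto)
  show ?thesis using generating_S almost_convex_S by blast
qed

end
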